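(* Let $G \subset \mathbf{Sp}(2,1)$ be a non-elementary quaternionic hyperbolic Kleinian group in which every element of $G$ has real trace. Then $G$ is Fuchsian; that is, $G$ leaves invariant (as a set) at least one of the following totally geodesic submanifolds of quaternionic hyperbolic $2$-space $\mathbf{H}^2_{\mathbb{H}}$: a quaternionic line, a complex line, a copy of $\mathbf{H}^2_{\mathbb{C}}$, or a copy of $\mathbf{H}^2_{\mathbb{R}}$.
   Context: $\mathbb{H}$ denotes the quaternions. $\mathbb{H}^{2,1}$ is the space $\mathbb{H}^3$ of column vectors $p=(p_1,p_2,p_3)^t$, regarded as a right $\mathbb{H}$-vector space, with the Hermitian form of signature $(2,1)$ $$\langle p,q\rangle = q^*Jp=\overline{q_1}p_3+\overline{q_2}p_2+\overline{q_3}p_1,\qquad J=\begin{pmatrix}0&0&1\\0&1&0\\1&0&0\end{pmatrix}.$$ $\mathbf{Sp}(2,1)=\{A\in GL(3,\mathbb{H}) : A^*JA=J\}$, where $A^*$ is the conjugate transpose. The trace of a matrix $A\in\mathbf{Sp}(2,1)$ is the sum of its diagonal entries (a quaternion); it is called real if it lies in $\mathbb{R}$. Let $\mathbb{P}\mathbb{H}^{2,1}$ be the set of right quaternionic lines $p\mathbb{H}$, $p\ne 0$. Quaternionic hyperbolic $2$-space is $\mathbf{H}^2_{\mathbb{H}}=\{p\mathbb{H} : \langle p,p\rangle<0\}$ (with the Bergman metric), with boundary at infinity $\partial\mathbf{H}^2_{\mathbb{H}}=\{p\mathbb{H} : p\neq 0,\ \langle p,p\rangle=0\}$. The group $\mathbf{Sp}(2,1)$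 acts on $\mathbf{H}^2_{\mathbb{H}}$ by isometries via $p\mathbb{H}\mapsto (Ap)\mathbb{H}$. A quaternionic hyperbolic Kleinian group is a discrete subgroup of $\mathbf{Sp}(2,1)$. Its limit set is the set of accumulation points in $\partial\mathbf{H}^2_{\mathbb{H}}$ of an orbit of a point of $\mathbf{H}^2_{\mathbb{H}}$. The group is elementary if its limit set consists of at most two points, and non-elementary otherwise. Totally geodesic submanifolds, with $\mathbb{C}=\mathbb{R}+\mathbb{R}i\subset\mathbb{H}$: a copy of $\mathbf{H}^2_{\mathbb{R}}$ (respectively of $\mathbf{H}^2_{\mathbb{C}}$) is the image under an element of $\mathbf{Sp}(2,1)$ of the set of points of $\mathbf{H}^2_{\mathbb{H}}$ of the form $p\mathbb{H}$ with $p\in\mathbb{R}^3$ (respectively $p\in\mathbb{C}^3$). A quaternionic line (respectively complex line) is the image under an element of $\mathbf{Sp}(2,1)$ of the set of points of $\mathbf{H}^2_{\mathbb{H}}$ of the form $p\mathbb{H}$ with $p=(p_1,0,p_3)^t$, $p_1,p_3\in\mathbb{H}$ (respectively $p_1,p_3\in\mathbb{C}$). *)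

theory Defs
  imports "HOL-Analysis.Analysis" "HOL-Algebra.Group"
begin

section \<open>Quaternions\<close>

codatatype quat = Quat (QRe: real) (QI: real) (QJ: real) (QK: real)

lemma quat_eq_iff: "x = y \<longleftrightarrow> QRe x = QRe y \<and> QI x = QI y \<and> QJ x = QJ y \<and> QK x = QK y"
  by (auto intro: quat.expand)

instantiation quat :: ab_group_add
begin

primcorec zero_quat where
  "QRe 0 = 0" | "QI 0 = 0" | "QJ 0 = 0" | "QK 0 = 0"

primcorec plus_quat where
  "QRe (x + y) = QRe x + QRe y"
| "QI (x + y) = QI x + QI y"
| "QJ (x + y) = QJ x + QJ y"
| "QK (x + y) = QK x + QK y"

primcorec uminus_quat where
  "QRe (- x) = - QRe x"
| "QI (- x) = - QI x"
| "QJ (- x) = - QJ x"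
| "QK (- x) = - QK x"

primcorec minus_quat where
  "QRe (x - y) = QRe x - QRe y"
| "QI (x - y) = QI x - QI y"
| "QJ (x - y) = QJ x - QJ y"
| "QK (x - y) = QK x - QK y"

instance by standard (simp_all add: quat_eq_iff)

end

instantiation quat :: ring_1
begin

primcorec one_quat where
  "QRe 1 = 1" | "QI 1 = 0" | "QJ 1 = 0" | "QK 1 = 0"

primcorec times_quat where
  "QRe (x * y) = QRe x * QRe y - QI x * QI y - QJ x * QJ y - QK x * QK y"
| "QI (x * y) = QRe x * QI y + QI x * QRe y + QJ x * QK y - QK x * QJ y"
| "QJ (x * y) = QRe x * QJ y - QI x * QK y + QJ x * QRe y + QK x * QI y"
| "QK (x * y) = QRe x * QK y + QI x * QJ y - QJ x * QI y + QK x * QRe y"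

instance by standard (simp_all add: quat_eq_iff algebra_simps)

end

instantiation quat :: real_algebra_1
begin

primcorec scaleR_quat where
  "QRe (scaleR r x) = r * QRe x"
| "QI (scaleR r x) = r * QI x"
| "QJ (scaleR r x) = r * QJ x"
| "QK (scaleR r x) = r * QK x"

instance by standard (simp_all add: quat_eq_iff algebra_simps)

end

lemma QRe_of_real [simp]: "QRe (of_real r) = r"
  and QI_of_real [simp]: "QI (of_real r) = 0"
  and QJ_of_real [simp]: "QJ (of_real r) = 0"
  and QK_of_real [simp]: "QK (of_real r) = 0"
  by (simp_all add: of_real_def)

lemma quat_Reals_iff: "x \<in> \<real> \<longleftrightarrow> QI x = 0 \<and> QJ x = 0 \<and> QK x = 0"
proof
  assume "QI x = 0 \<and> QJ x = 0 \<and> QK x = 0"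
  then have "x = of_real (QRe x)"
    by (simp add: quat_eq_iff)
  then show "x \<in> \<real>"
    by (metis Reals_of_real)
qed (auto elim!: Reals_cases)

primcorec qcnj :: "quat \<Rightarrow> quat" where
  "QRe (qcnj x) = QRe x"
| "QI (qcnj x) = - QI x"
| "QJ (qcnj x) = - QJ x"
| "QK (qcnj x) = - QK x"

lemma qcnj_add [simp]: "qcnj (x + y) = qcnj x + qcnj y"
  and qcnj_mult [simp]: "qcnj (x * y) = qcnj y * qcnj x"
  and qcnj_qcnj [simp]: "qcnj (qcnj x) = x"
  and qcnj_0 [simp]: "qcnj 0 = 0"
  and qcnj_1 [simp]: "qcnj 1 = 1"
  by (simp_all add: quat_eq_iff algebra_simps)

lemma qcnj_sum: "qcnj (sum f A) = (\<Sum>a\<in>A. qcnj (f a))"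
  by (induction A rule: infinite_finite_induct) auto

lemma quat_sumsq_pos:
  assumes "x \<noteq> 0"
  shows "(QRe x)\<^sup>2 + (QI x)\<^sup>2 + (QJ x)\<^sup>2 + (QK x)\<^sup>2 > 0"
proof -
  have "\<not> (QRe x)\<^sup>2 + (QI x)\<^sup>2 + (QJ x)\<^sup>2 + (QK x)\<^sup>2 \<le> 0"
    using assms by (smt (verit) quat_eq_iff zero_quat.sel zero_le_power2 zero_less_power2)
  then show ?thesis by simp
qed

instantiation quat :: real_div_algebra
begin

definition inverse_quat :: "quat \<Rightarrow> quat" where
  "inverse x = qcnj x /\<^sub>R ((QRe x)\<^sup>2 + (QI x)\<^sup>2 + (QJ x)\<^sup>2 + (QK x)\<^sup>2)"

definition divide_quat :: "quat \<Rightarrow> quat \<Rightarrow> quat" where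
  "x div y = x * inverse y" for x y :: quat

instance
proof
  fix x y :: quat
  assume "x \<noteq> 0"
  then have *: "(QRe x)\<^sup>2 + (QI x)\<^sup>2 + (QJ x)\<^sup>2 + (QK x)\<^sup>2 \<noteq> 0" (is "?n \<noteq> 0")
    using quat_sumsq_pos by force
  have l: "qcnj x * x = of_real ?n" and r: "x * qcnj x = of_real ?n"
    by (simp_all add: quat_eq_iff power2_eq_square algebra_simps)
  have "inverse x * x = (qcnj x * x) /\<^sub>R ?n"
    by (simp add: inverse_quat_def)
  then show "inverse x * x = 1"
    using * unfolding l by (simp add: of_real_def)
  have "x * inverse x = (x * qcnj x) /\<^sub>R ?n"
    by (simp add: inverse_quat_def)
  then show "x * inverse x = 1"
    using * unfolding r by (simp add: of_real_def)
next
  fix x y :: quat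
  show "x div y = x * inverse y"
    by (rule divide_quat_def)
  show "inverse (0::quat) = 0"
    by (simp add: inverse_quat_def quat_eq_iff)
qed

end

instantiation quat :: real_inner
begin

definition inner_quat :: "quat \<Rightarrow> quat \<Rightarrow> real" where
  "inner x y = QRe x * QRe y + QI x * QI y + QJ x * QJ y + QK x * QK y"

definition norm_quat :: "quat \<Rightarrow> real" where
  "norm x = sqrt ((QRe x)\<^sup>2 + (QI x)\<^sup>2 + (QJ x)\<^sup>2 + (QK x)\<^sup>2)"

definition sgn_quat :: "quat \<Rightarrow> quat" where
  "sgn x = x /\<^sub>R norm x" for x :: quat

definition dist_quat :: "quat \<Rightarrow> quat \<Rightarrow> real" where
  "dist x y = norm (x - y)" for x y :: quat

definition uniformity_quat :: "(quat \<times> quat) filter" where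
  "uniformity_quat = (INF e\<in>{0 <..}. principal {(x, y). dist x y < e})"

definition open_quat :: "quat set \<Rightarrow> bool" where
  "open_quat U \<longleftrightarrow> (\<forall>x\<in>U. eventually (\<lambda>(x', y). x' = x \<longrightarrow> y \<in> U) uniformity)"

instance
proof
  fix x y z :: quat and r :: real and U :: "quat set"
  show "inner x y = inner y x"
    by (simp add: inner_quat_def mult.commute)
  show "inner (x + y) z = inner x z + inner y z" "inner (r *\<^sub>R x) y = r * inner x y"
    by (simp_all add: inner_quat_def algebra_simps)
  show "0 \<le> inner x x"
    by (simp add: inner_quat_def)
  show "inner x x = 0 \<longleftrightarrow> x = 0"
    using quat_sumsq_pos[of x] by (cases "x = 0") (simp_all add: inner_quat_def power2_eq_square)
  show "norm x = sqrt (inner x x)"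
    by (simp add: norm_quat_def inner_quat_def power2_eq_square)
  show "sgn x = x /\<^sub>R norm x" "dist x y = norm (x - y)"
    "(uniformity :: (quat \<times> quat) filter) = (INF e\<in>{0 <..}. principal {(x, y). dist x y < e})"
    "open U \<longleftrightarrow> (\<forall>x\<in>U. eventually (\<lambda>(x', y). x' = x \<longrightarrow> y \<in> U) uniformity)"
    by (rule sgn_quat_def dist_quat_def uniformity_quat_def open_quat_def)+
qed

end

instance quat :: real_normed_div_algebra
proof
  fix x y :: quat
  show "norm (x * y) = norm x * norm y"
    unfolding norm_quat_def real_sqrt_mult[symmetric]
    by (rule arg_cong[of _ _ sqrt]) (simp add: power2_eq_square algebra_simps)
qed

text \<open>The subfield \<open>\<real> + \<real>i\<close>.\<close>

definition quat_complex :: "quat set" where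
  "quat_complex = {z. QJ z = 0 \<and> QK z = 0}"


section \<open>The group \<open>Sp(2,1)\<close>\<close>

definition mat_cnj_transpose :: "quat ^ 'n ^ 'm \<Rightarrow> quat ^ 'm ^ 'n" where
  "mat_cnj_transpose A = (\<chi> i j. qcnj (A $ j $ i))"

definition J21 :: "quat ^ 3 ^ 3" where
  "J21 = vector [vector [0, 0, 1], vector [0, 1, 0], vector [1, 0, 0]]"

definition hform :: "quat ^ 3 \<Rightarrow> quat ^ 3 \<Rightarrow> quat" where
  "hform p q = qcnj (q $ 1) * p $ 3 + qcnj (q $ 2) * p $ 2 + qcnj (q $ 3) * p $ 1"

lemma hform_J21: "hform p q = (\<Sum>i\<in>UNIV. qcnj (q $ i) * (J21 *v p) $ i)"
  by (simp add: hform_def J21_def sum_3 matrix_vector_mult_def)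

lemma hform_self_Reals: "hform p p \<in> \<real>"
  by (simp add: hform_def quat_Reals_iff algebra_simps)

definition Sp21 :: "(quat ^ 3 ^ 3) set" where
  "Sp21 = {A. invertible A \<and> mat_cnj_transpose A ** J21 ** A = J21}"

definition Sp21_group :: "(quat ^ 3 ^ 3) monoid" where
  "Sp21_group = \<lparr>carrier = Sp21, mult = (**), one = mat 1\<rparr>"

lemma mat_cnj_transpose_mult:
  "mat_cnj_transpose (A ** B) = mat_cnj_transpose B ** mat_cnj_transpose A"
  by (simp add: mat_cnj_transpose_def matrix_matrix_mult_def vec_eq_iff qcnj_sum)

lemma mat_cnj_transpose_one: "mat_cnj_transpose (mat 1) = mat 1"
  by (simp add: mat_cnj_transpose_def mat_def vec_eq_iff)

lemma Sp21_mult_closed: "A \<in> Sp21 \<Longrightarrow> B \<in> Sp21 \<Longrightarrow> A ** B \<in> Sp21"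
proof -
  assume A: "A \<in> Sp21" and B: "B \<in> Sp21"
  then have "mat_cnj_transpose (A ** B) ** J21 ** (A ** B)
      = mat_cnj_transpose B ** (mat_cnj_transpose A ** J21 ** A) ** B"
    by (simp add: mat_cnj_transpose_mult matrix_mul_assoc)
  with A B show ?thesis
    by (simp add: Sp21_def invertible_mult)
qed

lemma Sp21_inverse:
  assumes "A \<in> Sp21"
  obtains B where "B \<in> Sp21" "B ** A = mat 1" "A ** B = mat 1"
proof -
  from assms obtain B where B: "A ** B = mat 1" "B ** A = mat 1"
    by (auto simp: Sp21_def invertible_def)
  have "mat_cnj_transpose B ** J21 ** B
      = mat_cnj_transpose B ** (mat_cnj_transpose A ** J21 ** A) ** B"
    using assms by (simp add: Sp21_def)
  also have "\<dots> = mat_cnj_transpose (A ** B) ** J21 ** (A ** B)"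
    by (simp add: mat_cnj_transpose_mult matrix_mul_assoc)
  finally have "B \<in> Sp21"
    using B by (auto simp: Sp21_def invertible_def mat_cnj_transpose_one)
  with B that show thesis by blast
qed

lemma group_Sp21: "group Sp21_group"
proof (rule groupI)
  show "\<one>\<^bsub>Sp21_group\<^esub> \<in> carrier Sp21_group"
    by (auto simp: Sp21_group_def Sp21_def mat_cnj_transpose_one invertible_def)
  show "\<exists>y\<in>carrier Sp21_group. y \<otimes>\<^bsub>Sp21_group\<^esub> x = \<one>\<^bsub>Sp21_group\<^esub>"
    if "x \<in> carrier Sp21_group" for x
    using that Sp21_inverse by (auto simp: Sp21_group_def)
qed (auto simp: Sp21_group_def Sp21_mult_closed matrix_mul_assoc)


section \<open>The projective space and quaternionic hyperbolic space\<close>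

text \<open>A point \<open>p H\<close> of the projective space is represented by the set of all right multiples of \<open>p\<close>,
  so that an element \<open>A\<close> of the group acts on it by taking the image under \<open>(*v) A\<close>.\<close>

definition rline :: "quat ^ 3 \<Rightarrow> (quat ^ 3) set" where
  "rline p = range (\<lambda>h. \<chi> i. p $ i * h)"

definition act :: "quat ^ 3 ^ 3 \<Rightarrow> (quat ^ 3) set \<Rightarrow> (quat ^ 3) set" where
  "act A L = (*v) A ` L"

lemma act_rline: "act A (rline p) = rline (A *v p)"
  by (simp add: act_def rline_def image_image matrix_vector_mult_def sum_distrib_right mult.assoc)

definition PH21 :: "(quat ^ 3) set set" where
  "PH21 = {rline p | p. p \<noteq> 0}"

definition PH21_top :: "(quat ^ 3) set topology" where
  "PH21_top = topology (\<lambda>U. U \<subseteq> PH21 \<and> open {p. p \<noteq> 0 \<and> rline p \<in> U})"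

lemma openin_PH21_top: "openin PH21_top U \<longleftrightarrow> U \<subseteq> PH21 \<and> open {p. p \<noteq> 0 \<and> rline p \<in> U}"
proof -
  let ?pre = "\<lambda>U. {p. p \<noteq> 0 \<and> rline p \<in> U}"
  have "?pre (S \<inter> T) = ?pre S \<inter> ?pre T" "?pre (\<Union>K) = (\<Union>U\<in>K. ?pre U)" for S T K
    by auto
  then have "istopology (\<lambda>U. U \<subseteq> PH21 \<and> open (?pre U))"
    unfolding istopology_def by auto
  then show ?thesis
    by (simp add: PH21_top_def)
qed

lemma quotient_map_rline: "quotient_map (top_of_set (- {0})) PH21_top rline"
proof -
  have "{p. p \<noteq> 0 \<and> rline p \<in> PH21} = - {0}"
    by (auto simp: PH21_def)
  then have "openin PH21_top PH21"
    by (simp add: openin_PH21_top open_Compl)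
  then have top: "topspace PH21_top = PH21"
    by (metis openin_PH21_top openin_subset openin_topspace subset_antisym)
  show ?thesis
    unfolding quotient_map_def top
  proof (intro conjI allI impI)
    show "rline ` topspace (top_of_set (- {0})) = PH21"
      by (auto simp: PH21_def)
    fix U assume "U \<subseteq> PH21"
    then show "openin (top_of_set (- {0})) {x \<in> topspace (top_of_set (- {0})). rline x \<in> U}
        \<longleftrightarrow> openin PH21_top U"
      by (auto simp: openin_PH21_top openin_open_eq open_Compl)
  qed
qed

text \<open>The value \<open>hform p p\<close> is always real, see \<open>hform_self_Reals\<close>.\<close>

definition H2H :: "(quat ^ 3) set set" where
  "H2H = {rline p | p. QRe (hform p p) < 0}"

definition bdry_H2H :: "(quat ^ 3) set set" where
  "bdry_H2H = {rline p | p. p \<noteq> 0 \<and> hform p p = 0}"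


section \<open>Kleinian groups and limit sets\<close>

definition kleinian :: "(quat ^ 3 ^ 3) set \<Rightarrow> bool" where
  "kleinian G \<longleftrightarrow> subgroup G Sp21_group \<and> discrete G"

text \<open>Accumulation points are taken in the quotient topology of the whole projective space,
  so that an orbit inside \<open>H2H\<close> can accumulate at the boundary.\<close>

definition limit_set :: "(quat ^ 3 ^ 3) set \<Rightarrow> (quat ^ 3) set \<Rightarrow> (quat ^ 3) set set" where
  "limit_set G x = bdry_H2H \<inter> PH21_top derived_set_of ((\<lambda>A. act A x) ` G)"

text \<open>For a discrete group the limit set does not depend on the base point \<open>x\<close>; quantifying over
  all base points avoids building this fact into the definition.\<close>

definition elementary :: "(quat ^ 3 ^ 3) set \<Rightarrow> bool" where
  "elementary G \<longleftrightarrow> (\<forall>x\<in>H2H. finite (limit_set G x) \<and> card (limit_set G x) \<le> 2)"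


section \<open>Totally geodesic submanifolds and Fuchsian groups\<close>

definition std_real_plane :: "(quat ^ 3) set set" where
  "std_real_plane = H2H \<inter> {rline p | p. \<forall>i. p $ i \<in> \<real>}"

definition std_complex_plane :: "(quat ^ 3) set set" where
  "std_complex_plane = H2H \<inter> {rline p | p. \<forall>i. p $ i \<in> quat_complex}"

definition std_quaternionic_line :: "(quat ^ 3) set set" where
  "std_quaternionic_line = H2H \<inter> {rline p | p. p $ 2 = 0}"

definition std_complex_line :: "(quat ^ 3) set set" where
  "std_complex_line =
    H2H \<inter> {rline p | p. p $ 1 \<in> quat_complex \<and> p $ 2 = 0 \<and> p $ 3 \<in> quat_complex}"

definition Sp21_copies :: "(quat ^ 3) set set \<Rightarrow> (quat ^ 3) set set set" where
  "Sp21_copies M = {act A ` M | A. A \<in> Sp21}"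

definition leaves_invariant :: "(quat ^ 3 ^ 3) set \<Rightarrow> (quat ^ 3) set set \<Rightarrow> bool" where
  "leaves_invariant G M \<longleftrightarrow> (\<forall>A\<in>G. act A ` M = M)"

definition fuchsian :: "(quat ^ 3 ^ 3) set \<Rightarrow> bool" where
  "fuchsian G \<longleftrightarrow>
    (\<exists>M \<in> Sp21_copies std_quaternionic_line \<union> Sp21_copies std_complex_line
        \<union> Sp21_copies std_complex_plane \<union> Sp21_copies std_real_plane.
      leaves_invariant G M)"

end

(*
  Let G be irreducible on the right quaternionic space H^3, and let B be the real algebra generated
  by G and the right multiplications by quaternions.  If only real scalars commuted with G, Jacobson
  density would make B the algebra of all real linear maps, and averaging over conjugation by the
  units 1, i, j, k would show that the real span of G contains diag(i,0,0), whose trace is not real.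
  So some nonscalar X commutes with G.  It satisfies a real quadratic equation (take an eigenvector
  and use irreducibility), and the skew part of X with respect to the Hermitian form yields a
  complex structure K with K^2 = -1 and adj K = -K that commutes with G.  The vectors v with
  K v = v i form a complex Hermitian space of signature (2,1), which is a G-invariant copy of complex
  hyperbolic space.

  If G is reducible, it fixes a quaternionic line q H: take an invariant subspace or its orthogonal
  complement.  When q is positive, the complement of q is an invariant quaternionic line.  When q is
  negative, or null with all multipliers of modulus one, the quantity |<y,q>|^2 / |<y,y>| is constant
  on orbits, so orbits accumulate at q H only.  When q is null and L in G acts on q H with multiplier
  of modulus greater than one, L has a second null eigenvector v; the conjugates L^-n B L^n of any B
  in G stay bounded and are distinct unless B fixes v H, so by discreteness all of G fixes v H, and
  the limit set is contained in {q H, v H}.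
*)

theory Submission
  imports Defs "HOL-Computational_Algebra.Fundamental_Theorem_Algebra"
begin

section \<open>Right quaternionic vectors and the Hermitian form\<close>

text \<open>Makes \<open>quat ^ 3\<close> a real Euclidean space, where injective linear
  endomorphisms are surjective, proper subspaces have orthogonal vectors and bounded sequences have
  convergent subsequences.\<close>

instantiation quat :: euclidean_space
begin

definition Basis_quat :: "quat set" where
  "Basis_quat = {Quat 1 0 0 0, Quat 0 1 0 0, Quat 0 0 1 0, Quat 0 0 0 1}"

instance
proof
  show "inner u v = (if u = v then 1 else 0)" if "u \<in> Basis" "v \<in> Basis" for u v :: quat
    using that by (elim Basis_quat_def[THEN equalityD1, THEN subsetD, THEN insertE] insertE emptyE)
      (simp_all add: inner_quat_def)
  show "(\<forall>u\<in>Basis. inner x u = 0) \<longleftrightarrow> x = 0" for x :: quat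
    by (simp add: Basis_quat_def inner_quat_def quat_eq_iff[of x])
qed (simp_all add: Basis_quat_def)

end

lemma qcnj_of_real [simp]: "qcnj (of_real r) = of_real r"
  and qcnj_minus [simp]: "qcnj (- x) = - qcnj x"
  and qcnj_diff [simp]: "qcnj (x - y) = qcnj x - qcnj y"
  and qcnj_scaleR [simp]: "qcnj (r *\<^sub>R x) = r *\<^sub>R qcnj x"
  and norm_qcnj [simp]: "norm (qcnj x) = norm x"
  by (simp_all add: quat_eq_iff norm_quat_def)

lemma qcnj_eq_0_iff [simp]: "qcnj x = 0 \<longleftrightarrow> x = 0"
  by (metis qcnj_0 qcnj_qcnj)

lemma qcnj_mult_self: "qcnj x * x = of_real ((norm x)\<^sup>2)" "x * qcnj x = of_real ((norm x)\<^sup>2)"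
  by (simp_all add: quat_eq_iff norm_quat_def power2_eq_square algebra_simps)

lemma QRe_real_sandwich: "QRe (qcnj h * (of_real r * h)) = (norm h)\<^sup>2 * r"
  by (simp add: norm_quat_def power2_eq_square algebra_simps)

lemma bounded_linear_qcnj: "bounded_linear qcnj"
  by (rule bounded_linear_intro[of _ 1]) auto

lemmas continuous_on_qcnj [continuous_intros] = bounded_linear.continuous_on[OF bounded_linear_qcnj]

text \<open>Scalars act on the right so that they commute with matrices acting on the left.\<close>

definition rmult :: "quat ^ 3 \<Rightarrow> quat \<Rightarrow> quat ^ 3"  (infixl \<open>\<star>\<close> 75) where
  "v \<star> h = (\<chi> i. v $ i * h)"

lemma rmult_nth [simp]: "(v \<star> h) $ i = v $ i * h"
  by (simp add: rmult_def)

lemma rline_rmult: "rline p = range ((\<star>) p)"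
  by (simp add: rline_def rmult_def)

lemma rmult_simps [simp]:
  "v \<star> 0 = 0" "0 \<star> h = 0" "v \<star> 1 = v" "v \<star> (- h) = - (v \<star> h)" "(- v) \<star> h = - (v \<star> h)"
  by (simp_all add: vec_eq_iff)

lemma rmult_add_left: "(v + w) \<star> h = v \<star> h + w \<star> h"
  and rmult_add_right: "v \<star> (g + h) = v \<star> g + v \<star> h"
  and rmult_diff_left: "(v - w) \<star> h = v \<star> h - w \<star> h"
  and rmult_diff_right: "v \<star> (g - h) = v \<star> g - v \<star> h"
  and rmult_assoc: "v \<star> g \<star> h = v \<star> (g * h)"
  and rmult_of_real: "v \<star> of_real r = r *\<^sub>R v"
  and rmult_scaleR_left: "(r *\<^sub>R v) \<star> h = r *\<^sub>R (v \<star> h)"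
  and rmult_scaleR_right: "v \<star> (r *\<^sub>R h) = r *\<^sub>R (v \<star> h)"
  by (simp_all add: vec_eq_iff algebra_simps of_real_def)

lemma rmult_eq_0_iff [simp]: "v \<star> h = 0 \<longleftrightarrow> v = 0 \<or> h = 0"
  by (auto simp: vec_eq_iff)

lemma norm_rmult: "norm (v \<star> h) = norm v * norm h"
  by (simp add: norm_vec_def norm_mult L2_set_left_distrib)

lemma mult_rmult: "A *v (v \<star> h) = (A *v v) \<star> h"
  by (simp add: vec_eq_iff matrix_vector_mult_def sum_distrib_right mult.assoc)

lemma mult_scaleR_vector: "A *v (r *\<^sub>R v) = r *\<^sub>R (A *v v)" for A :: "quat ^ 3 ^ 3"
  by (metis mult_rmult rmult_of_real)

lemma scaleR_mult_vector: "(r *\<^sub>R A) *v v = r *\<^sub>R (A *v v)" for A :: "quat ^ 3 ^ 3"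
  by (simp add: vec_eq_iff matrix_vector_mult_def scaleR_sum_right)

section \<open>The Hermitian form and its isometries\<close>

lemma hform_simps [simp]:
  "hform 0 q = 0" "hform p 0 = 0" "hform (- p) q = - hform p q" "hform p (- q) = - hform p q"
  by (simp_all add: hform_def)

lemma hform_add_left: "hform (p + p') q = hform p q + hform p' q"
  and hform_add_right: "hform p (q + q') = hform p q + hform p q'"
  and hform_diff_left: "hform (p - p') q = hform p q - hform p' q"
  and hform_diff_right: "hform p (q - q') = hform p q - hform p q'"
  and hform_rmult_left: "hform (p \<star> h) q = hform p q * h"
  and hform_rmult_right: "hform p (q \<star> h) = qcnj h * hform p q"
  and hform_scaleR_left: "hform (r *\<^sub>R p) q = r *\<^sub>R hform p q"
  and hform_scaleR_right: "hform p (r *\<^sub>R q) = r *\<^sub>R hform p q"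
  by (simp_all add: hform_def algebra_simps)

lemma qcnj_hform: "qcnj (hform p q) = hform q p"
  by (simp add: hform_def)

lemma hform_eq_0_sym: "hform p q = 0 \<longleftrightarrow> hform q p = 0"
  by (metis qcnj_hform qcnj_0)

lemma hform_self: "hform p p = of_real (QRe (hform p p))"
  by (metis hform_self_Reals QRe_of_real Reals_cases)

lemma hform_self_rmult: "QRe (hform (p \<star> h) (p \<star> h)) = (norm h)\<^sup>2 * QRe (hform p p)"
proof -
  have "hform (p \<star> h) (p \<star> h) = qcnj h * (of_real (QRe (hform p p)) * h)"
    by (simp add: hform_rmult_left hform_rmult_right mult.assoc flip: hform_self)
  then show ?thesis
    by (simp only: QRe_real_sandwich)
qed

lemma hform_self_add:
  assumes "hform p q = 0"
  shows "hform (p + q) (p + q) = hform p p + hform q q"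
  using assms hform_eq_0_sym[of p q] by (simp add: hform_add_left hform_add_right)

lemma hform_axis:
  "hform p (axis 1 1) = p $ 3" "hform p (axis 2 1) = p $ 2" "hform p (axis 3 1) = p $ 1"
  by (simp_all add: hform_def axis_def)

lemma hform_nondegenerate:
  assumes "\<And>q. hform p q = 0" shows "p = 0"
  using hform_axis[of p] assms by (simp add: vec_eq_iff forall_3)

lemma hform_nondegenerate_eq:
  assumes "\<And>p. hform p q = hform p q'" shows "q = q'"
proof -
  have "q - q' = 0"
    by (rule hform_nondegenerate) (metis assms hform_diff_right hform_eq_0_sym right_minus_eq)
  then show ?thesis by simp
qed

text \<open>The adjoint with respect to \<open>hform\<close>: the conjugate transpose, conjugated by
  the Gram matrix \<open>J21\<close>, which is its own inverse.\<close>

definition adj :: "quat ^ 3 ^ 3 \<Rightarrow> quat ^ 3 ^ 3" where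
  "adj X = J21 ** mat_cnj_transpose X ** J21"

lemma J21_mult_vec: "J21 *v p = vector [p $ 3, p $ 2, p $ 1]"
  by (simp add: J21_def vec_eq_iff matrix_vector_mult_def sum_3 forall_3)

lemma J21_J21: "J21 ** J21 = mat 1"
  by (simp add: matrix_eq matrix_vector_mul_assoc[symmetric] J21_mult_vec vec_eq_iff forall_3)

lemma hform_adj: "hform (X *v p) q = hform p (adj X *v q)"
proof -
  have "adj X *v q = vector [qcnj (X $ 1 $ 3) * q $ 3 + qcnj (X $ 2 $ 3) * q $ 2 + qcnj (X $ 3 $ 3) * q $ 1,
      qcnj (X $ 1 $ 2) * q $ 3 + qcnj (X $ 2 $ 2) * q $ 2 + qcnj (X $ 3 $ 2) * q $ 1,
      qcnj (X $ 1 $ 1) * q $ 3 + qcnj (X $ 2 $ 1) * q $ 2 + qcnj (X $ 3 $ 1) * q $ 1]"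
    unfolding adj_def matrix_vector_mul_assoc[symmetric] J21_mult_vec
    by (simp add: vec_eq_iff forall_3 matrix_vector_mult_def mat_cnj_transpose_def sum_3)
  then show ?thesis
    by (simp add: hform_def matrix_vector_mult_def sum_3 algebra_simps)
qed

lemma hform_adj': "hform p (X *v q) = hform (adj X *v p) q"
  by (metis hform_adj qcnj_hform)

lemma adj_unique:
  assumes "\<And>p q. hform (X *v p) q = hform p (Y *v q)"
  shows "adj X = Y"
  unfolding matrix_eq
  by (intro allI hform_nondegenerate_eq) (metis assms hform_adj)

lemma adj_mult: "adj (X ** Y) = adj Y ** adj X"
  by (rule adj_unique) (simp add: hform_adj matrix_vector_mul_assoc[symmetric])

lemma adj_adj [simp]: "adj (adj X) = X"
  by (rule adj_unique) (metis hform_adj hform_adj')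

lemma adj_diff: "adj (X - Y) = adj X - adj Y"
  by (rule adj_unique)
    (simp add: hform_adj matrix_vector_mult_diff_rdistrib hform_diff_left hform_diff_right)

lemma adj_scaleR: "adj (r *\<^sub>R X) = r *\<^sub>R adj X"
  by (rule adj_unique)
    (simp add: hform_adj scaleR_mult_vector hform_scaleR_left hform_scaleR_right)

lemma adj_mat_1 [simp]: "adj (mat 1) = mat 1"
  by (rule adj_unique) simp

text \<open>The library has this only over fields.\<close>

lemma quat_matrix_left_right_inverse:
  fixes X Y :: "quat ^ 3 ^ 3"
  assumes "X ** Y = mat 1"
  shows "Y ** X = mat 1"
proof -
  have XY: "X *v (Y *v v) = v" for v
    using assms by (simp add: matrix_vector_mul_assoc)
  have "inj ((*v) Y)"
    by (rule inj_on_inverseI[of _ "(*v) X"]) (rule XY)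
  then have "surj ((*v) Y)"
    by (intro linear_inj_imp_surj matrix_vector_mul_linear)
  then have "Y *v (X *v w) = w" for w
  proof -
    from surjD[OF \<open>surj ((*v) Y)\<close>, of w] obtain v where "w = Y *v v" by blast
    then show ?thesis by (simp only: XY)
  qed
  then show ?thesis
    by (simp add: matrix_eq flip: matrix_vector_mul_assoc)
qed

text \<open>Multiplying the defining equation by the involution \<open>J21\<close> shows that
  \<open>adj A\<close> inverts \<open>A\<close>; inverses in the group are thus given by a real
  linear map.\<close>

lemma Sp21_iff_adj: "A \<in> Sp21 \<longleftrightarrow> adj A ** A = mat 1"
proof
  assume "A \<in> Sp21"
  then have "J21 ** (mat_cnj_transpose A ** J21 ** A) = mat 1"
    by (simp add: Sp21_def J21_J21)
  then show "adj A ** A = mat 1"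
    by (simp only: adj_def matrix_mul_assoc)
next
  assume *: "adj A ** A = mat 1"
  have "mat_cnj_transpose A ** J21 ** A = (J21 ** J21) ** mat_cnj_transpose A ** J21 ** A"
    by (simp add: J21_J21)
  also have "\<dots> = J21 ** (adj A ** A)"
    by (simp only: adj_def matrix_mul_assoc)
  also have "\<dots> = J21"
    by (simp add: *)
  finally have "mat_cnj_transpose A ** J21 ** A = J21" .
  moreover have "invertible A"
    unfolding invertible_def
    by (intro exI[of _ "adj A"] conjI * quat_matrix_left_right_inverse[OF *])
  ultimately show "A \<in> Sp21"
    unfolding Sp21_def by simp
qed

lemma Sp21_adj:
  assumes "A \<in> Sp21"
  shows "adj A ** A = mat 1" "A ** adj A = mat 1"
proof -
  show *: "adj A ** A = mat 1" using assms by (simp add: Sp21_iff_adj)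
  show "A ** adj A = mat 1" by (rule quat_matrix_left_right_inverse[OF *])
qed

lemma Sp21_adj_cancel [simp]:
  assumes "A \<in> Sp21"
  shows "adj A *v (A *v p) = p" "A *v (adj A *v p) = p"
  using assms by (simp_all add: matrix_vector_mul_assoc Sp21_adj)

lemma Sp21_hform: "A \<in> Sp21 \<Longrightarrow> hform (A *v p) (A *v q) = hform p q"
  by (simp add: hform_adj)

lemma Sp21_eq_0_iff [simp]: "A \<in> Sp21 \<Longrightarrow> A *v p = 0 \<longleftrightarrow> p = 0"
  by (metis Sp21_adj_cancel(1) matrix_vector_mult_0_right)

text \<open>The combination \<open>r\<close> of \<open>p\<close> and \<open>q\<close> in the proof lies in the positive definite subspace where the
  first and third coordinates agree.\<close>

lemma hform_nonpos_orthogonal: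
  assumes p: "p \<noteq> 0" "QRe (hform p p) \<le> 0" and q: "QRe (hform q q) \<le> 0" and pq: "hform q p = 0"
  obtains a where "q = p \<star> a"
proof -
  have pos: "r = 0" if "r $ 1 = r $ 3" "QRe (hform r r) \<le> 0" for r :: "quat ^ 3"
  proof -
    have hr: "hform r r = of_real ((norm (r $ 1))\<^sup>2 + (norm (r $ 2))\<^sup>2 + (norm (r $ 1))\<^sup>2)"
      unfolding hform_def that(1) qcnj_mult_self of_real_add ..
    have *: "(norm (r $ 1))\<^sup>2 + (norm (r $ 2))\<^sup>2 + (norm (r $ 1))\<^sup>2 \<le> 0"
      using that(2) unfolding hr QRe_of_real .
    have "(norm (r $ 1))\<^sup>2 = 0" "(norm (r $ 2))\<^sup>2 = 0"
      using * zero_le_power2[of "norm (r $ 1)"] zero_le_power2[of "norm (r $ 2)"] by linarith+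
    then show "r = 0" using that(1) by (simp add: vec_eq_iff forall_3)
  qed
  define \<alpha> where "\<alpha> = p $ 1 - p $ 3"
  have "\<alpha> \<noteq> 0" using pos[of p] p by (auto simp: \<alpha>_def)
  define a where "a = inverse \<alpha> * (q $ 1 - q $ 3)"
  define r where "r = q + p \<star> (- a)"
  have "\<alpha> * a = q $ 1 - q $ 3"
    using \<open>\<alpha> \<noteq> 0\<close> by (simp add: a_def mult.assoc[symmetric])
  then have "r $ 1 = r $ 3"
    by (simp add: r_def \<alpha>_def algebra_simps)
  moreover have "QRe (hform r r) \<le> 0"
  proof -
    have "hform q (p \<star> (- a)) = 0" by (simp add: hform_rmult_right pq del: rmult_simps)
    then have "QRe (hform r r) = QRe (hform q q) + (norm a)\<^sup>2 * QRe (hform p p)"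
      by (simp add: r_def hform_self_add hform_self_rmult del: rmult_simps)
    with p q show ?thesis by (smt (verit) mult_nonneg_nonpos zero_le_power2)
  qed
  ultimately have "r = 0" by (rule pos)
  then have "q = p \<star> a" by (simp add: r_def)
  with that show thesis .
qed

text \<open>Otherwise \<open>q\<close> would be a multiple of \<open>p\<close> by
  \<open>hform_nonpos_orthogonal\<close>, and orthogonality to the negative vector \<open>p\<close>
  would make it zero.\<close>

lemma hform_neg_orthogonal:
  assumes "QRe (hform p p) < 0" "hform q p = 0" "q \<noteq> 0"
  shows "QRe (hform q q) > 0"
proof (rule ccontr)
  assume *: "\<not> QRe (hform q q) > 0"
  have "p \<noteq> 0" using assms by auto
  with * assms obtain a where a: "q = p \<star> a"
    by (meson hform_nonpos_orthogonal linorder_not_less less_imp_le)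
  with assms(2) have "hform p p = 0 \<or> a = 0" by (simp add: hform_rmult_left)
  with assms a show False by auto
qed

text \<open>Two linear conditions in three dimensions: padding the two pairings with a zero gives a
  real linear endomorphism that is not surjective, hence not injective.\<close>

lemma nonzero_orthogonal_exists:
  obtains q where "q \<noteq> 0" "hform q a = 0" "hform q b = 0"
proof -
  let ?f = "\<lambda>q::quat^3. vector [hform q a, hform q b, 0] :: quat^3"
  have "linear ?f"
    by (rule linearI)
      (simp_all add: vec_eq_iff forall_3 hform_add_left hform_scaleR_left)
  moreover have "\<not> surj ?f"
  proof
    assume "surj ?f"
    from surjD[OF this, of "axis 3 1"] obtain q where "axis 3 1 = ?f q" by blast
    from arg_cong[OF this, of "\<lambda>v. v $ 3"] show False by (simp add: axis_def)
  qed
  ultimately have "\<not> inj ?f"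
    using linear_inj_imp_surj by blast
  with \<open>linear ?f\<close> obtain q where "q \<noteq> 0" "?f q = 0"
    using linear_injective_0[of ?f] by blast
  with that show thesis by (simp add: vec_eq_iff forall_3)
qed

definition cols :: "quat ^ 3 \<Rightarrow> quat ^ 3 \<Rightarrow> quat ^ 3 \<Rightarrow> quat ^ 3 ^ 3" where
  "cols a b c = (\<chi> i. vector [a $ i, b $ i, c $ i])"

lemma cols_mult_vec: "cols a b c *v p = a \<star> p $ 1 + b \<star> p $ 2 + c \<star> p $ 3"
  by (simp add: cols_def vec_eq_iff matrix_vector_mult_def sum_3)

lemma vec3_expand:
  fixes p :: "quat ^ 3" shows "p = axis 1 1 \<star> p $ 1 + axis 2 1 \<star> p $ 2 + axis 3 1 \<star> p $ 3"
  by (simp add: vec_eq_iff forall_3 axis_def)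

text \<open>The hypotheses say that \<open>a\<close>, \<open>b\<close>, \<open>c\<close> have the
  Gram matrix of the standard basis.\<close>

lemma cols_Sp21:
  assumes "hform a a = 0" "hform c c = 0" "hform b b = 1"
    and "hform a c = 1" "hform a b = 0" "hform b c = 0"
  shows "cols a b c \<in> Sp21"
proof -
  have *: "hform b a = 0" "hform c b = 0" "hform c a = 1"
    using qcnj_hform[of a b] qcnj_hform[of b c] qcnj_hform[of a c] assms by simp_all
  have "hform p (adj (cols a b c) *v (cols a b c *v q)) = hform p q" for p q
    unfolding hform_adj[symmetric] cols_mult_vec
    by (simp add: hform_add_left hform_add_right hform_rmult_left hform_rmult_right assms *
        hform_def[of p q])
  then have "adj (cols a b c) *v (cols a b c *v q) = q" for q
    by (rule hform_nondegenerate_eq)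
  then show ?thesis
    by (simp add: Sp21_iff_adj matrix_eq flip: matrix_vector_mul_assoc)
qed

section \<open>Limit sets, invariant submanifolds and discreteness\<close>

lemma subgroup_Sp21:
  assumes "subgroup G Sp21_group"
  shows "G \<subseteq> Sp21" "mat 1 \<in> G" "A \<in> G \<Longrightarrow> B \<in> G \<Longrightarrow> A ** B \<in> G" "A \<in> G \<Longrightarrow> adj A \<in> G"
proof -
  show sub: "G \<subseteq> Sp21" and one: "mat 1 \<in> G" and "A \<in> G \<Longrightarrow> B \<in> G \<Longrightarrow> A ** B \<in> G"
    using subgroup.subset[OF assms] subgroup.one_closed[OF assms] subgroup.m_closed[OF assms]
    by (auto simp: Sp21_group_def)
  assume "A \<in> G"
  with sub have A: "A \<in> Sp21" by blast
  then have "adj A \<in> Sp21"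
    by (simp add: Sp21_iff_adj Sp21_adj)
  with A have "inv\<^bsub>Sp21_group\<^esub> A = adj A"
    by (intro group.inv_equality[OF group_Sp21]) (auto simp: Sp21_group_def Sp21_adj)
  then show "adj A \<in> G"
    using subgroup.m_inv_closed[OF assms \<open>A \<in> G\<close>] by simp
qed

section \<open>Projective lines and invariant submanifolds\<close>

lemma in_rline_iff: "q \<in> rline p \<longleftrightarrow> (\<exists>h. q = p \<star> h)"
  by (auto simp: rline_rmult)

lemma rline_eqD:
  assumes "rline p = rline q"
  obtains h where "q = p \<star> h"
proof -
  have "q \<in> rline q"
    unfolding in_rline_iff by (rule exI[of _ 1]) simp
  then have "q \<in> rline p"
    by (simp add: assms)
  with that show thesis
    by (auto simp: in_rline_iff)
qed

lemma rline_rmult_eq: "a \<noteq> 0 \<Longrightarrow> rline (p \<star> a) = rline p"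
  by (auto simp: rline_rmult rmult_assoc image_iff)
    (metis mult.assoc mult_1 right_inverse rmult_assoc)

lemma act_H2H_subset:
  assumes "S \<in> Sp21"
  shows "act S ` (H2H \<inter> {rline p | p. P p}) =
    {rline w | w. w \<in> (*v) S ` {p. P p} \<and> QRe (hform w w) < 0}" (is "?L = ?R")
proof
  show "?L \<subseteq> ?R"
  proof clarify
    fix p assume "rline p \<in> H2H" "P p"
    \<comment> \<open>The negative representative of the line need not be the one satisfying
      \<open>P\<close>, but rescaling carries negativity over.\<close>
    then obtain q where q: "rline p = rline q" "QRe (hform q q) < 0"
      by (auto simp: H2H_def)
    then obtain h where "q = p \<star> h" by (metis rline_eqD)
    with q have "(norm h)\<^sup>2 * QRe (hform p p) < 0"
      by (simp add: hform_self_rmult)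
    then have "QRe (hform p p) < 0"
      by (simp add: mult_less_0_iff)
    then show "\<exists>w. act S (rline p) = rline w \<and> w \<in> (*v) S ` {p. P p} \<and> QRe (hform w w) < 0"
      using assms \<open>P p\<close> by (intro exI[of _ "S *v p"]) (simp add: act_rline Sp21_hform)
  qed
  show "?R \<subseteq> ?L"
  proof clarify
    fix p assume "P p" "QRe (hform (S *v p) (S *v p)) < 0"
    then show "rline (S *v p) \<in> ?L"
      using assms
      by (intro image_eqI[of _ _ "rline p"]) (auto simp: act_rline Sp21_hform H2H_def)
  qed
qed

lemma leaves_invariantI:
  assumes G: "subgroup G Sp21_group"
    and W: "\<And>A w. A \<in> G \<Longrightarrow> w \<in> W \<Longrightarrow> A *v w \<in> W"
  shows "leaves_invariant G {rline w | w. w \<in> W \<and> QRe (hform w w) < 0}" (is "leaves_invariant G ?N")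
proof -
  note G' = subgroup_Sp21[OF G]
  have sub: "act A L \<in> ?N" if "A \<in> G" "L \<in> ?N" for A L
    using that W G'(1) by (auto simp: act_rline Sp21_hform subset_iff)
  show ?thesis
    unfolding leaves_invariant_def
  proof (intro ballI subset_antisym subsetI)
    fix A L assume A: "A \<in> G" and L: "L \<in> ?N"
    \<comment> \<open>Forward invariance under the inverse \<open>adj A\<close> gives the reverse
      inclusion.\<close>
    have "L = act A (act (adj A) L)"
      using A G'(1) by (simp add: act_def image_image subset_iff)
    then show "L \<in> act A ` ?N"
      by (rule image_eqI) (rule sub[OF G'(4)[OF A] L])
  qed (use sub in auto)
qed

text \<open>Reduces invariance of a submanifold to invariance of a set of vectors, described by
  \<open>P\<close> in the coordinates given by \<open>S\<close>.\<close>

lemma fuchsianI: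
  assumes G: "subgroup G Sp21_group"
    and S: "S \<in> Sp21"
    and W: "\<And>A p. A \<in> G \<Longrightarrow> P p \<Longrightarrow> \<exists>p'. P p' \<and> A *v (S *v p) = S *v p'"
    and M: "H2H \<inter> {rline p | p. P p} \<in> {std_quaternionic_line, std_complex_plane}"
  shows "fuchsian G"
proof -
  have "leaves_invariant G (act S ` (H2H \<inter> {rline p | p. P p}))"
    unfolding act_H2H_subset[OF S]
    by (rule leaves_invariantI[OF G]) (use W in auto)
  moreover have "act S ` (H2H \<inter> {rline p | p. P p})
      \<in> Sp21_copies std_quaternionic_line \<union> Sp21_copies std_complex_plane"
    using S M by (auto simp: Sp21_copies_def)
  ultimately show ?thesis
    unfolding fuchsian_def by blast
qed

section \<open>Limit points of orbits\<close>

lemma continuous_on_hform_left: "continuous_on S (\<lambda>y. hform y p)"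
  unfolding hform_def by (intro continuous_intros)

lemma continuous_on_hform_self: "continuous_on S (\<lambda>y. hform y y)"
  unfolding hform_def by (intro continuous_intros)

text \<open>The quotient of \<open>\<bar>hform y p\<bar> * \<bar>hform y v\<bar>\<close> by \<open>\<bar>hform y y\<bar>\<close> is constant on orbits, but
  tends to infinity at every null line other than those of \<open>p\<close> and \<open>v\<close>.\<close>

lemma elementaryI:
  assumes G: "G \<subseteq> Sp21"
    and p: "p \<noteq> 0" "QRe (hform p p) \<le> 0" and v: "v \<noteq> 0" "QRe (hform v v) \<le> 0"
    and inv: "\<And>A x. A \<in> G \<Longrightarrow>
      norm (hform (A *v x) p) * norm (hform (A *v x) v) = norm (hform x p) * norm (hform x v)"
  shows "elementary G"
proof -
  have "limit_set G x \<subseteq> {rline p, rline v}" if x: "x \<in> H2H" for x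
  proof
    fix L assume L: "L \<in> limit_set G x"
    then obtain q where q: "L = rline q" "q \<noteq> 0" "hform q q = 0"
      by (auto simp: limit_set_def bdry_H2H_def)
    from x obtain x0 where x0: "x = rline x0" "QRe (hform x0 x0) < 0"
      by (auto simp: H2H_def)
    define f where "f y = norm (hform y p) * norm (hform y v)" for y
    \<comment> \<open>\<open>K\<close> is the value of the quotient on the orbit of
      \<open>x0\<close>. With the denominator cleared, \<open>g\<close> makes sense at null vectors
      too, and it vanishes on the orbit.\<close>
    define K where "K = f x0 / \<bar>QRe (hform x0 x0)\<bar>"
    define g where "g y = f y - K * norm (hform y y)" for y
    have norm_self: "norm (hform y y) = \<bar>QRe (hform y y)\<bar>" for y
      by (subst hform_self) (simp only: norm_of_real)
    have g_rmult: "g (y \<star> h) = (norm h)\<^sup>2 * g y" for y h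
      by (simp add: g_def f_def hform_rmult_left hform_rmult_right norm_mult power2_eq_square algebra_simps)
    have "hform q p = 0 \<or> hform q v = 0"
    proof (rule ccontr)
      assume "\<not> ?thesis"
      then have "g q > 0"
        by (simp add: g_def f_def q)
      \<comment> \<open>By \<open>g_rmult\<close> the sign of \<open>g\<close> depends only on the
        line, so \<open>U\<close> is an open neighbourhood of \<open>L\<close> that the orbit must
        enter.\<close>
      define U where "U = {rline y | y. y \<noteq> 0 \<and> g y > 0}"
      have pre: "{y. y \<noteq> 0 \<and> rline y \<in> U} = {y. y \<noteq> 0} \<inter> {y. g y > 0}"
      proof (intro subset_antisym subsetI)
        fix y assume "y \<in> {y. y \<noteq> 0 \<and> rline y \<in> U}"
        then have "y \<noteq> 0" "rline y \<in> U" by auto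
        then obtain z where z: "rline z = rline y" "z \<noteq> 0" "g z > 0"
          by (auto simp: U_def)
        then obtain h where h: "y = z \<star> h" by (metis rline_eqD)
        with \<open>y \<noteq> 0\<close> z show "y \<in> {y. y \<noteq> 0} \<inter> {y. g y > 0}"
          by (simp add: g_rmult)
      qed (auto simp: U_def)
      have "continuous_on UNIV g"
        unfolding g_def f_def
        by (intro continuous_intros continuous_on_hform_left continuous_on_hform_self)
      then have "open {y. g y > 0}"
        by (intro open_Collect_less) (auto intro: continuous_intros)
      moreover have "open {y::quat^3. y \<noteq> 0}"
        by (simp add: open_Collect_neq)
      ultimately have "openin PH21_top U"
        unfolding openin_PH21_top pre by (auto simp: U_def PH21_def)
      moreover have "L \<in> U"
        using q \<open>g q > 0\<close> by (auto simp: U_def)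
      ultimately obtain A where A: "A \<in> G" "act A x \<in> U"
        using L by (auto simp: limit_set_def in_derived_set_of)
      with x0 have "rline (A *v x0) \<in> U" by (simp add: act_rline)
      moreover have "x0 \<noteq> 0" using x0 by auto
      moreover have "A \<in> Sp21" using A G by auto
      ultimately have "A *v x0 \<in> {y. g y > 0}"
        using pre by (metis (mono_tags, lifting) IntE Sp21_eq_0_iff mem_Collect_eq)
      moreover have "g (A *v x0) = 0"
        using A \<open>A \<in> Sp21\<close> x0(2) inv[OF A(1)]
        by (simp add: g_def f_def K_def norm_self Sp21_hform)
      ultimately show False by simp
    qed
    then have "\<exists>a. q = p \<star> a \<or> q = v \<star> a"
      using hform_nonpos_orthogonal[OF p, of q] hform_nonpos_orthogonal[OF v, of q] q(3)
      by (metis order_refl zero_quat.sel(1))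
    then show "L \<in> {rline p, rline v}"
      using q(1,2) by (auto simp: rline_rmult_eq)
  qed
  moreover have "card {rline p, rline v} \<le> 2"
    by (simp add: card_insert_if)
  moreover have "finite {rline p, rline v}" by simp
  ultimately show ?thesis
    unfolding elementary_def by (meson card_mono finite_subset le_trans)
qed

section \<open>Bounded sequences in discrete groups\<close>

lemma linear_adj: "linear adj"
proof (rule linearI)
  show "adj (X + Y) = adj X + adj Y" for X Y
    by (rule adj_unique)
      (simp add: hform_adj matrix_vector_mult_add_rdistrib hform_add_left hform_add_right)
qed (rule adj_scaleR)

lemma tendsto_adj: "(f \<longlongrightarrow> l) F \<Longrightarrow> ((\<lambda>x. adj (f x)) \<longlongrightarrow> adj l) F"
  using linear_adj linear_conv_bounded_linear bounded_linear.tendsto by blast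

lemma tendsto_matrix_mult:
  fixes f g :: "'a \<Rightarrow> quat ^ 3 ^ 3"
  assumes "(f \<longlongrightarrow> l) F" "(g \<longlongrightarrow> m) F"
  shows "((\<lambda>x. f x ** g x) \<longlongrightarrow> l ** m) F"
  unfolding matrix_matrix_mult_def
  by (intro vec_tendstoI) (simp, intro tendsto_intros assms)

text \<open>Along a convergent subsequence the quotients of consecutive terms tend to the identity,
  so by discreteness they eventually equal it and terms repeat.\<close>

lemma kleinian_bounded_not_inj:
  fixes f :: "nat \<Rightarrow> quat ^ 3 ^ 3"
  assumes "kleinian G" "range f \<subseteq> G" "bounded (range f)"
  shows "\<not> inj f"
proof
  assume "inj f"
  have G: "subgroup G Sp21_group" "discrete G" using assms by (auto simp: kleinian_def)
  note G' = subgroup_Sp21[OF G(1)]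
  obtain l r where r: "strict_mono (r :: nat \<Rightarrow> nat)" and l: "(f \<circ> r) \<longlonglongrightarrow> l"
    using bounded_imp_convergent_subsequence[OF assms(3)] by blast
  define g where "g n = f (r n)" for n
  have g: "g \<longlonglongrightarrow> l" using l by (simp add: g_def[abs_def] o_def)
  have gG: "g n \<in> G" for n using assms(2) by (auto simp: g_def)
  then have Sp: "g n \<in> Sp21" for n using G'(1) by blast
  have "(\<lambda>n. adj (g n) ** g n) \<longlonglongrightarrow> adj l ** l"
    by (intro tendsto_matrix_mult tendsto_adj g)
  then have "adj l ** l = mat 1"
    by (simp add: Sp Sp21_adj LIMSEQ_const_iff)
  moreover have "(\<lambda>n. adj (g n) ** g (Suc n)) \<longlonglongrightarrow> adj l ** l"
    by (intro tendsto_matrix_mult tendsto_adj g LIMSEQ_Suc)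
  ultimately have lim: "(\<lambda>n. adj (g n) ** g (Suc n)) \<longlonglongrightarrow> mat 1" by simp
  obtain T where T: "open T" "T \<inter> G = {mat 1}"
    using G(2) G'(2) by (auto simp: discrete_def isolated_in_def)
  then have "eventually (\<lambda>n. adj (g n) ** g (Suc n) \<in> T) sequentially"
    using lim by (auto simp: tendsto_def)
  then obtain n where "adj (g n) ** g (Suc n) \<in> T"
    by (auto simp: eventually_sequentially)
  then have "adj (g n) ** g (Suc n) = mat 1"
    using T G'(3,4) gG by blast
  then have "g n ** (adj (g n) ** g (Suc n)) = g n" by simp
  then have "g (Suc n) = g n"
    by (simp add: matrix_mul_assoc Sp Sp21_adj)
  then have "r (Suc n) = r n"
    using \<open>inj f\<close> by (simp add: g_def inj_eq)
  with r show False
    by (metis lessI less_irrefl strict_mono_def)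
qed

section \<open>Bases and eigenvectors of isometries\<close>

lemma cols_surj:
  assumes "\<And>y. cols a b c *v y = 0 \<Longrightarrow> y = 0"
  obtains y where "x = cols a b c *v y"
proof -
  have "inj ((*v) (cols a b c))"
    using assms by (subst linear_injective_0) auto
  then have "surj ((*v) (cols a b c))"
    by (intro linear_inj_imp_surj matrix_vector_mul_linear)
  from surjD[OF this, of x] that show thesis by blast
qed

text \<open>Commutators of quaternions have real part zero; \<open>loxodromicI\<close> uses this to
  show that a map is not surjective.\<close>

lemma QRe_mult_commute: "QRe (x * y) = QRe (y * x)"
  by (simp add: algebra_simps)

lemma Sp21_eigenvector_hform:
  assumes "A \<in> Sp21" "A *v q = q \<star> a"
  shows "hform x q = qcnj a * hform (A *v x) q"
  by (metis Sp21_hform[OF assms(1)] assms(2) hform_rmult_right)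

lemma Sp21_eigenvector_nonzero:
  assumes "A \<in> Sp21" "A *v q = q \<star> a" "q \<noteq> 0"
  shows "a \<noteq> 0"
  using assms by (metis Sp21_eq_0_iff rmult_eq_0_iff)

lemma Sp21_eigenvalue_norm:
  assumes "A \<in> Sp21" "A *v q = q \<star> a" "QRe (hform q q) \<noteq> 0"
  shows "norm a = 1"
proof -
  have "QRe (hform q q) = (norm a)\<^sup>2 * QRe (hform q q)"
    by (metis Sp21_hform assms(1,2) hform_self_rmult)
  with assms(3) have "(norm a)\<^sup>2 = 1" by simp
  then show ?thesis
    by (simp add: power2_eq_1_iff) (smt (verit) norm_ge_zero)
qed

section \<open>Invariant subspaces\<close>

text \<open>The Euclidean inner product with \<open>y\<close> is the real part of the pairing with
  \<open>J21 *v y\<close>. Since \<open>W\<close> is closed under right scalars, a vanishing real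
  part forces the whole pairing to vanish: test it on \<open>w \<star> qcnj z\<close>.\<close>

lemma orthogonal_to_right_subspace_exists:
  assumes add: "\<And>w w'. w \<in> W \<Longrightarrow> w' \<in> W \<Longrightarrow> w + w' \<in> W"
    and rmult: "\<And>w h. w \<in> W \<Longrightarrow> w \<star> h \<in> W"
    and "W \<noteq> {}" "W \<noteq> UNIV"
  obtains q where "q \<noteq> 0" "\<And>w. w \<in> W \<Longrightarrow> hform w q = 0"
proof -
  have "subspace W"
  proof (rule subspaceI)
    show "0 \<in> W" using \<open>W \<noteq> {}\<close> rmult[of _ 0] by auto
    show "r *\<^sub>R w \<in> W" if "w \<in> W" for r w
      using rmult[OF that, of "of_real r"] by (simp add: rmult_of_real)
  qed (rule add)
  then have spanW: "span W = W"
    by (rule span_eq_iff[THEN iffD2])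
  then have "span W \<subset> span UNIV"
    using \<open>W \<noteq> UNIV\<close> unfolding spanW by auto
  from orthogonal_to_subspace_exists_gen[OF this]
  obtain y where y: "y \<noteq> 0" "\<And>w. w \<in> span W \<Longrightarrow> orthogonal y w"
    by metis
  show thesis
  proof
    show "J21 *v y \<noteq> 0"
      using y(1) by (auto simp: J21_mult_vec vec_eq_iff forall_3)
    fix w assume "w \<in> W"
    define z where "z = hform w (J21 *v y)"
    have "QRe (hform v (J21 *v y)) = inner y v" for v
      by (simp add: J21_mult_vec hform_def inner_vec_def sum_3 inner_quat_def)
    moreover have "w \<star> qcnj z \<in> span W"
      unfolding spanW by (rule rmult[OF \<open>w \<in> W\<close>])
    ultimately have "QRe (hform (w \<star> qcnj z) (J21 *v y)) = 0"
      using y(2) by (simp add: orthogonal_def)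
    then have "QRe (z * qcnj z) = 0"
      by (simp only: hform_rmult_left z_def)
    then show "hform w (J21 *v y) = 0"
      unfolding qcnj_mult_self QRe_of_real by (simp add: z_def)
  qed
qed

text \<open>If \<open>W\<close> is not itself a line, it is two-dimensional, and its orthogonal
  complement is an invariant line.\<close>

lemma invariant_line_exists:
  assumes G: "subgroup G Sp21_group"
    and add: "\<And>w w'. w \<in> W \<Longrightarrow> w' \<in> W \<Longrightarrow> w + w' \<in> W"
    and rmult: "\<And>w h. w \<in> W \<Longrightarrow> w \<star> h \<in> W"
    and inv: "\<And>A w. A \<in> G \<Longrightarrow> w \<in> W \<Longrightarrow> A *v w \<in> W"
    and w1: "w1 \<in> W" "w1 \<noteq> 0" and W: "W \<noteq> UNIV"
  obtains q where "q \<noteq> 0" "\<And>A. A \<in> G \<Longrightarrow> \<exists>a. A *v q = q \<star> a"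
proof (cases "\<forall>w\<in>W. \<exists>h. w = w1 \<star> h")
  case True
  show thesis
  proof
    show "w1 \<noteq> 0" by (rule w1)
    show "\<exists>a. A *v w1 = w1 \<star> a" if "A \<in> G" for A
      using True inv[OF that w1(1)] by blast
  qed
next
  case False
  then obtain w2 where w2: "w2 \<in> W" "\<And>h. w2 \<noteq> w1 \<star> h" by blast
  obtain q where q: "q \<noteq> 0" "\<And>w. w \<in> W \<Longrightarrow> hform w q = 0"
    using orthogonal_to_right_subspace_exists[OF add rmult _ W] w1 by blast
  obtain w where "hform w q \<noteq> 0"
    using hform_nondegenerate[of q] q(1) hform_eq_0_sym by blast
  \<comment> \<open>Scaled so that pairing with \<open>q\<close> reads off the last coordinate in
    the basis \<open>w1\<close>, \<open>w2\<close>, \<open>w3\<close>.\<close>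
  define w3 where "w3 = w \<star> inverse (hform w q)"
  have w3: "hform w3 q = 1"
    using \<open>hform w q \<noteq> 0\<close> by (simp add: w3_def hform_rmult_left)
  have pair: "hform (cols w1 w2 w3 *v y) q = y $ 3" for y
    by (simp add: cols_mult_vec hform_add_left hform_rmult_left q w1 w2 w3)
  have trivial: "y = 0" if "cols w1 w2 w3 *v y = 0" for y
  proof -
    have y3: "y $ 3 = 0" using pair[of y] that by simp
    have sum: "w1 \<star> y $ 1 + w2 \<star> y $ 2 = 0"
      using that by (simp add: cols_mult_vec y3)
    have y2: "y $ 2 = 0"
    proof (rule ccontr)
      assume "y $ 2 \<noteq> 0"
      from sum have "w2 \<star> y $ 2 = w1 \<star> (- y $ 1)"
        by (simp add: eq_neg_iff_add_eq_0 add.commute)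
      then have "w2 \<star> y $ 2 \<star> inverse (y $ 2) = w1 \<star> (- y $ 1) \<star> inverse (y $ 2)"
        by simp
      with \<open>y $ 2 \<noteq> 0\<close> have "w2 = w1 \<star> (- y $ 1 * inverse (y $ 2))"
        by (simp add: rmult_assoc del: rmult_simps(4))
      with w2 show False by blast
    qed
    with sum w1 have "y $ 1 = 0" by simp
    with y2 y3 show "y = 0" by (simp add: vec_eq_iff forall_3)
  qed
  \<comment> \<open>A vector \<open>q'\<close> orthogonal to \<open>W\<close> is determined by its
    pairing with \<open>w3\<close>, hence is a multiple of \<open>q\<close>.\<close>
  have line: "\<exists>a. q' = q \<star> a" if "\<And>w. w \<in> W \<Longrightarrow> hform w q' = 0" for q'
  proof -
    have "hform x q' = hform x (q \<star> qcnj (hform w3 q'))" for x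
    proof -
      obtain y where "x = cols w1 w2 w3 *v y" using cols_surj trivial by metis
      then show ?thesis
        by (simp add: hform_rmult_right pair)
          (simp add: cols_mult_vec hform_add_left hform_rmult_left that w1 w2)
    qed
    then show ?thesis using hform_nondegenerate_eq by blast
  qed
  show thesis
  proof
    show "q \<noteq> 0" by (rule q)
    fix A assume A: "A \<in> G"
    \<comment> \<open>The inverse \<open>adj A\<close> preserves \<open>W\<close>, so
      \<open>A\<close> preserves the complement of \<open>W\<close>.\<close>
    show "\<exists>a. A *v q = q \<star> a"
      by (rule line) (simp add: hform_adj' q inv A subgroup_Sp21[OF G])
  qed
qed

section \<open>Orthonormal frames\<close>

lemma quat_numeral_sel [simp]:
  "QRe (numeral n) = numeral n" "QI (numeral n) = 0" "QJ (numeral n) = 0" "QK (numeral n) = 0"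
  by (metis QRe_of_real QI_of_real QJ_of_real QK_of_real of_real_numeral)+

lemma normalize:
  assumes "QRe (hform q q) \<noteq> 0"
  obtains r where "r > 0" "hform (r *\<^sub>R q) (r *\<^sub>R q) = of_real (sgn (QRe (hform q q)))"
proof -
  define s where "s = QRe (hform q q)"
  show thesis
  proof
    show "1 / sqrt \<bar>s\<bar> > 0" using assms by (simp add: s_def)
    have "hform ((1 / sqrt \<bar>s\<bar>) *\<^sub>R q) ((1 / sqrt \<bar>s\<bar>) *\<^sub>R q) = (1 / \<bar>s\<bar>) *\<^sub>R hform q q"
      by (simp add: hform_scaleR_left hform_scaleR_right)
    also have "\<dots> = (1 / \<bar>s\<bar>) *\<^sub>R of_real s"
      using hform_self[of q] by (simp add: s_def)
    also have "\<dots> = of_real (sgn s)"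
      by (simp add: of_real_def sgn_if)
    finally show "hform ((1 / sqrt \<bar>s\<bar>) *\<^sub>R q) ((1 / sqrt \<bar>s\<bar>) *\<^sub>R q) = of_real (sgn (QRe (hform q q)))"
      by (simp add: s_def)
  qed
qed

text \<open>The sum and difference of a positive and a negative unit vector are null, and the factor
  \<open>1 / sqrt 2\<close> makes their pairing one.\<close>

lemma frame_Sp21:
  assumes "hform v0 v0 = - 1" "hform v1 v1 = 1" "hform v2 v2 = 1"
    and "hform v1 v0 = 0" "hform v2 v0 = 0" "hform v2 v1 = 0"
  shows "cols ((1 / sqrt 2) *\<^sub>R (v1 + v0)) v2 ((1 / sqrt 2) *\<^sub>R (v1 - v0)) \<in> Sp21"
proof -
  have *: "hform v0 v1 = 0" "hform v0 v2 = 0" "hform v1 v2 = 0"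
    using assms hform_eq_0_sym by blast+
  show ?thesis
    by (rule cols_Sp21)
      (simp_all add: hform_scaleR_left hform_scaleR_right hform_add_left hform_add_right
        hform_diff_left hform_diff_right assms * quat_eq_iff)
qed

text \<open>Witt extension for a positive unit vector. The vector \<open>n0\<close> has norm -2, and
  projecting it off \<open>u\<close> only lowers this, which gives a negative vector
  \<open>n\<close> orthogonal to \<open>u\<close>; any \<open>m\<close> orthogonal to both is
  positive and completes the frame.\<close>

lemma Sp21_second_column:
  assumes "hform u u = 1"
  obtains S where "S \<in> Sp21" "S *v axis 2 1 = u"
proof -
  define n0 :: "quat ^ 3" where "n0 = axis 1 1 - axis 3 1"
  define n where "n = n0 - u \<star> hform n0 u"
  have nu: "hform n u = 0"
    by (simp add: n_def hform_diff_left hform_rmult_left assms)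
  then have un: "hform u n = 0"
    using hform_eq_0_sym by blast
  have "hform n n = hform (n0 - u \<star> hform n0 u) n"
    unfolding n_def ..
  also have "\<dots> = hform n0 n"
    using un by (simp add: hform_diff_left hform_rmult_left)
  also have "\<dots> = hform n0 n0 - qcnj (hform n0 u) * hform n0 u"
    by (simp add: n_def hform_diff_right hform_rmult_right)
  also have "hform n0 n0 = - 2"
    by (simp add: n0_def hform_def axis_def)
  finally have "hform n n = - 2 - of_real ((norm (hform n0 u))\<^sup>2)"
    by (simp only: qcnj_mult_self)
  then have "QRe (hform n n) = - 2 - (norm (hform n0 u))\<^sup>2"
    by (simp del: of_real_power)
  then have neg: "QRe (hform n n) < 0"
    by (smt (verit) zero_le_power2)
  obtain m where m: "m \<noteq> 0" "hform m n = 0" "hform m u = 0"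
    using nonzero_orthogonal_exists by blast
  have pos: "QRe (hform m m) > 0"
    using hform_neg_orthogonal neg m by blast
  obtain r where r: "hform (r *\<^sub>R n) (r *\<^sub>R n) = - 1"
    using normalize[of n] neg by auto
  obtain s where s: "hform (s *\<^sub>R m) (s *\<^sub>R m) = 1"
    using normalize[of m] pos by auto
  have "hform u n = 0" "hform u m = 0"
    using nu m hform_eq_0_sym by blast+
  then have S: "cols ((1 / sqrt 2) *\<^sub>R (s *\<^sub>R m + r *\<^sub>R n)) u ((1 / sqrt 2) *\<^sub>R (s *\<^sub>R m - r *\<^sub>R n)) \<in> Sp21"
    using r s m assms by (intro frame_Sp21) (simp_all only: hform_scaleR_left hform_scaleR_right, simp_all)
  show thesis
    by (rule that[OF S]) (simp add: cols_mult_vec axis_def)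
qed

lemma positive_invariant_line_fuchsian:
  assumes G: "subgroup G Sp21_group"
    and q: "QRe (hform q q) > 0" "\<And>A. A \<in> G \<Longrightarrow> \<exists>a. A *v q = q \<star> a"
  shows "fuchsian G"
proof -
  obtain r where r: "r > 0" "hform (r *\<^sub>R q) (r *\<^sub>R q) = 1"
    using normalize[of q] q(1) by auto
  then obtain S where S: "S \<in> Sp21" "S *v axis 2 1 = r *\<^sub>R q"
    using Sp21_second_column by blast
  \<comment> \<open>In the coordinates of \<open>S\<close> the orthogonal complement of
    \<open>q\<close> is where the second entry vanishes.\<close>
  have second: "p $ 2 = r *\<^sub>R hform (S *v p) q" for p
    using Sp21_hform[OF S(1), of p "axis 2 1"] by (simp add: hform_axis S(2) hform_scaleR_right)
  show ?thesis
  proof (rule fuchsianI[OF G S(1), of "\<lambda>p. p $ 2 = 0"])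
    show "\<exists>p'. p' $ 2 = 0 \<and> A *v (S *v p) = S *v p'" if A: "A \<in> G" and p: "p $ 2 = 0" for A p
    proof (intro exI conjI)
      show eq: "A *v (S *v p) = S *v (adj S *v (A *v (S *v p)))"
        by (simp add: S(1))
      obtain a where a: "A *v q = q \<star> a" using q(2)[OF A] by blast
      have "A \<in> Sp21" using subgroup_Sp21(1)[OF G] A by blast
      have "q \<noteq> 0" using q(1) by auto
      have "qcnj a * hform (A *v (S *v p)) q = 0"
        using second[of p] p r(1) Sp21_eigenvector_hform[OF \<open>A \<in> Sp21\<close> a, of "S *v p"] by simp
      then have "hform (A *v (S *v p)) q = 0"
        using Sp21_eigenvector_nonzero[OF \<open>A \<in> Sp21\<close> a \<open>q \<noteq> 0\<close>] by simp
      then show "(adj S *v (A *v (S *v p))) $ 2 = 0"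
        unfolding second eq[symmetric] by simp
    qed
  qed (simp add: std_quaternionic_line_def)
qed

section \<open>Invariant lines\<close>

primrec mpow :: "quat ^ 3 ^ 3 \<Rightarrow> nat \<Rightarrow> quat ^ 3 ^ 3" where
  "mpow A 0 = mat 1"
| "mpow A (Suc n) = A ** mpow A n"

lemma mpow_Sp21: "A \<in> Sp21 \<Longrightarrow> mpow A n \<in> Sp21"
proof (induction n)
  case 0
  show ?case by (simp add: Sp21_iff_adj)
qed (simp add: Sp21_mult_closed)

lemma mpow_in_subgroup: "subgroup G Sp21_group \<Longrightarrow> A \<in> G \<Longrightarrow> mpow A n \<in> G"
  by (induction n) (auto simp: subgroup_Sp21)

lemma mpow_eigenvector:
  assumes "A *v q = q \<star> a"
  shows "mpow A n *v q = q \<star> a ^ n"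
proof (induction n)
  case (Suc n)
  then show ?case
    by (simp add: mult_rmult assms rmult_assoc flip: matrix_vector_mul_assoc)
qed simp

lemma adj_eigenvector:
  assumes "A \<in> Sp21" "A *v q = q \<star> a" "q \<noteq> 0"
  shows "adj A *v q = q \<star> inverse a"
proof -
  have "a \<noteq> 0" using Sp21_eigenvector_nonzero[OF assms] .
  have "adj A *v q = adj A *v (A *v (q \<star> inverse a))"
    using \<open>a \<noteq> 0\<close> by (simp add: mult_rmult assms rmult_assoc del: Sp21_adj_cancel)
  also have "\<dots> = q \<star> inverse a"
    using assms(1) by simp
  finally show ?thesis .
qed

text \<open>A matrix depends linearly on its values on a fixed basis; \<open>T\<close> below is the
  inverse of the basis matrix.\<close>

lemma bounded_range_matrixI:
  fixes M :: "nat \<Rightarrow> quat ^ 3 ^ 3"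
  assumes surj: "\<And>x. \<exists>y. x = cols p u v *v y"
    and bd: "\<And>n. norm (M n *v p) \<le> K" "\<And>n. norm (M n *v u) \<le> K" "\<And>n. norm (M n *v v) \<le> K"
  shows "bounded (range M)"
proof -
  obtain t where t: "\<And>x. x = cols p u v *v t x" using surj by metis
  define T where "T = cols (t (axis 1 1)) (t (axis 2 1)) (t (axis 3 1))"
  have "cols p u v *v (T *v x) = x" for x
    unfolding T_def cols_mult_vec[of "t _"]
    by (simp only: matrix_vector_right_distrib mult_rmult t[symmetric] vec3_expand[symmetric])
  then have T: "cols p u v ** T = mat 1"
    by (simp add: matrix_eq flip: matrix_vector_mul_assoc)
  let ?f = "\<lambda>(a, b, c). cols a b c ** T"
  have "M n = ?f (M n *v p, M n *v u, M n *v v)" for n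
  proof -
    have "M n ** cols p u v = cols (M n *v p) (M n *v u) (M n *v v)"
      by (simp add: matrix_eq cols_mult_vec matrix_vector_right_distrib mult_rmult
          flip: matrix_vector_mul_assoc)
    then have "cols (M n *v p) (M n *v u) (M n *v v) ** T = M n ** (cols p u v ** T)"
      by (simp only: matrix_mul_assoc)
    then show ?thesis by (simp add: T)
  qed
  then have "range M \<subseteq> ?f ` (cball 0 K \<times> cball 0 K \<times> cball 0 K)"
    using bd by (auto simp: image_iff) (metis mem_cball_0 mem_Sigma_iff)
  moreover have "linear ?f"
    by (rule linearI)
      (auto simp: matrix_eq cols_mult_vec rmult_add_left rmult_scaleR_left scaleR_mult_vector
        scaleR_add_right matrix_vector_mult_add_rdistrib simp flip: matrix_vector_mul_assoc)
  ultimately show ?thesis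
    using bounded_linear_image bounded_Times bounded_cball linear_conv_bounded_linear bounded_subset
    by metis
qed

text \<open>A loxodromic isometry in an eigenbasis: attracting null line of \<open>p\<close>,
  repelling null line of \<open>v\<close>, and \<open>u\<close> orthogonal to both.\<close>

locale loxodromic =
  fixes L :: "quat ^ 3 ^ 3" and p u v :: "quat ^ 3" and a b c :: quat
  assumes L: "L \<in> Sp21" "L *v p = p \<star> a" "L *v u = u \<star> b" "L *v v = v \<star> c"
    and norms: "norm a > 1" "norm b = 1" "norm c < 1"
    and p: "p \<noteq> 0" "hform p p = 0" and v: "v \<noteq> 0" "hform v v = 0" and u: "u \<noteq> 0"
    and orth: "hform u p = 0" "hform u v = 0" "hform v p \<noteq> 0"
begin

lemma hform_combination:
  "hform (cols p u v *v y) p = hform v p * y $ 3"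
  "hform (cols p u v *v y) v = hform p v * y $ 1"
  by (simp_all add: cols_mult_vec hform_add_left hform_rmult_left p v orth)

lemma combination_eq_0:
  assumes "cols p u v *v y = 0" shows "y = 0"
proof -
  have "hform p v \<noteq> 0" using orth(3) hform_eq_0_sym by blast
  then have y: "y $ 1 = 0" "y $ 3 = 0"
    using hform_combination[of y] assms orth(3) by auto
  with assms have "u \<star> y $ 2 = 0" by (simp add: cols_mult_vec)
  with u have "y $ 2 = 0" by simp
  with y show ?thesis by (simp add: vec_eq_iff forall_3)
qed

lemma combination_inject: "cols p u v *v y = cols p u v *v y' \<longleftrightarrow> y = y'"
  using combination_eq_0[of "y - y'"] by (auto simp: matrix_vector_mult_diff_distrib)

lemma combination_exists: "\<exists>y. x = cols p u v *v y"
  using combination_eq_0 cols_surj by metis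

lemma combination_exists_orthogonal:
  assumes "hform x p = 0"
  shows "\<exists>\<beta> \<delta>. x = p \<star> \<beta> + u \<star> \<delta>"
proof -
  obtain y where y: "x = cols p u v *v y" using combination_exists by blast
  then have "y $ 3 = 0" using assms orth(3) by (simp add: hform_combination)
  then show ?thesis unfolding y cols_mult_vec by auto
qed

text \<open>\<open>B\<close> preserves the line of \<open>p\<close> and its orthogonal complement,
  so it is upper triangular in the basis \<open>p\<close>, \<open>u\<close>, \<open>v\<close>.
  Conjugation by powers of \<open>L\<close> keeps the norms of the diagonal entries and shrinks
  those above the diagonal.\<close>

lemma bounded_conjugates:
  assumes B: "B \<in> Sp21" "B *v p = p \<star> \<alpha>"
  shows "bounded (range (\<lambda>n. adj (mpow L n) ** B ** mpow L n))" (is "bounded (range ?M)")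
proof -
  note Ln = mpow_Sp21[OF L(1)]
  note ev = mpow_eigenvector[OF L(2)] mpow_eigenvector[OF L(3)] mpow_eigenvector[OF L(4)]
  note inv = adj_eigenvector[OF Ln ev(1) p(1)] adj_eigenvector[OF Ln ev(2) u]
    adj_eigenvector[OF Ln ev(3) v(1)]
  have "hform (B *v u) p = 0"
    using Sp21_eigenvector_hform[OF B, of u] Sp21_eigenvector_nonzero[OF B p(1)] orth by simp
  then obtain \<beta> \<delta> where Bu: "B *v u = p \<star> \<beta> + u \<star> \<delta>"
    using combination_exists_orthogonal by blast
  obtain y :: "quat ^ 3" where Bv: "B *v v = p \<star> y $ 1 + u \<star> y $ 2 + v \<star> y $ 3"
    using combination_exists[of "B *v v"] by (auto simp: cols_mult_vec)
  have ac: "inverse (norm a) ^ n \<le> 1" "norm c ^ n \<le> 1" for n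
    using norms by (auto simp: power_le_one inverse_le_1_iff)
  have "c \<noteq> 0" using Sp21_eigenvector_nonzero[OF L(1,4) v(1)] .
  have "a \<noteq> 0" using norms by auto
  have Mp: "norm (?M n *v p) \<le> norm p * norm \<alpha>" for n
  proof -
    have "?M n *v p = p \<star> (inverse (a ^ n) * (\<alpha> * a ^ n))"
      by (simp add: ev B mult_rmult inv rmult_assoc mult.assoc flip: matrix_vector_mul_assoc)
    then show ?thesis
      using \<open>a \<noteq> 0\<close>
      by (simp add: norm_rmult norm_mult norm_inverse norm_power) (simp add: field_simps)
  qed
  have Mu: "norm (?M n *v u) \<le> norm p * norm \<beta> + norm u * norm \<delta>" for n
  proof -
    have "?M n *v u = p \<star> (inverse (a ^ n) * (\<beta> * b ^ n)) + u \<star> (inverse (b ^ n) * (\<delta> * b ^ n))"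
      by (simp add: ev Bu mult_rmult inv rmult_assoc rmult_add_left matrix_vector_right_distrib
          mult.assoc flip: matrix_vector_mul_assoc)
    also have "norm \<dots> \<le> norm p * (inverse (norm a) ^ n * norm \<beta>) + norm u * norm \<delta>"
      by (rule norm_triangle_le) (simp add: norm_rmult norm_mult norm_inverse norm_power norms power_inverse)
    also have "\<dots> \<le> norm p * norm \<beta> + norm u * norm \<delta>"
      using ac(1)[of n] by (intro add_mono mult_left_mono mult_left_le_one_le) auto
    finally show ?thesis .
  qed
  have Mv: "norm (?M n *v v) \<le> norm p * norm (y $ 1) + norm u * norm (y $ 2) + norm v * norm (y $ 3)" for n
  proof -
    have "?M n *v v = p \<star> (inverse (a ^ n) * (y $ 1 * c ^ n)) + u \<star> (inverse (b ^ n) * (y $ 2 * c ^ n))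
        + v \<star> (inverse (c ^ n) * (y $ 3 * c ^ n))"
      by (simp add: ev Bv mult_rmult inv rmult_assoc rmult_add_left matrix_vector_right_distrib
          mult.assoc flip: matrix_vector_mul_assoc)
    also have "norm \<dots> \<le> norm p * (inverse (norm a) ^ n * (norm c ^ n * norm (y $ 1)))
        + norm u * (norm c ^ n * norm (y $ 2)) + norm v * norm (y $ 3)"
      using \<open>c \<noteq> 0\<close> by (intro norm_triangle_le add_mono)
        (simp_all add: norm_rmult norm_mult norm_inverse norm_power norms power_inverse mult.commute,
          simp add: field_simps)
    also have "\<dots> \<le> norm p * norm (y $ 1) + norm u * norm (y $ 2) + norm v * norm (y $ 3)"
      using ac[of n]
      by (intro add_mono mult_left_mono order_refl mult_left_le_one_le[THEN order_trans] mult_left_le_one_le) auto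
    finally show ?thesis .
  qed
  define K where "K = max (norm p * norm \<alpha>) (max (norm p * norm \<beta> + norm u * norm \<delta>)
    (norm p * norm (y $ 1) + norm u * norm (y $ 2) + norm v * norm (y $ 3)))"
  show ?thesis
  proof (rule bounded_range_matrixI[OF combination_exists])
    show "norm (?M n *v p) \<le> K" "norm (?M n *v u) \<le> K" "norm (?M n *v v) \<le> K" for n
      using Mp[of n] Mu[of n] Mv[of n] unfolding K_def by linarith+
  qed
qed

text \<open>The \<open>p\<close> and \<open>u\<close> coordinates of the conjugates applied to
  \<open>v\<close> have norms strictly decreasing in \<open>n\<close> unless they vanish, and if
  both vanish then \<open>B\<close> fixes the line of \<open>v\<close>.\<close>

lemma inj_conjugates:
  assumes B: "B \<in> Sp21" "\<And>h. B *v v \<noteq> v \<star> h"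
  shows "inj (\<lambda>n. adj (mpow L n) ** B ** mpow L n)" (is "inj ?M")
proof (rule injI, rule ccontr)
  fix m n assume eq: "?M m = ?M n" and "m \<noteq> n"
  note Ln = mpow_Sp21[OF L(1)]
  note ev = mpow_eigenvector[OF L(2)] mpow_eigenvector[OF L(3)] mpow_eigenvector[OF L(4)]
  note inv = adj_eigenvector[OF Ln ev(1) p(1)] adj_eigenvector[OF Ln ev(2) u]
    adj_eigenvector[OF Ln ev(3) v(1)]
  obtain y where y: "B *v v = cols p u v *v y"
    using combination_exists[of "B *v v"] by blast
  define z where "z n = (vector [inverse (a ^ n) * (y $ 1 * c ^ n), inverse (b ^ n) * (y $ 2 * c ^ n),
      inverse (c ^ n) * (y $ 3 * c ^ n)] :: quat ^ 3)" for n
  have "?M n *v v = cols p u v *v z n" for n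
    by (simp add: z_def ev y mult_rmult inv rmult_assoc rmult_add_left matrix_vector_right_distrib
        cols_mult_vec mult.assoc flip: matrix_vector_mul_assoc)
  with eq have "z m = z n" by (metis combination_inject)
  then have "z m $ 1 = z n $ 1" "z m $ 2 = z n $ 2" by simp_all
  moreover have "norm (z k $ 1) = (norm c / norm a) ^ k * norm (y $ 1)"
    "norm (z k $ 2) = norm c ^ k * norm (y $ 2)" for k
    by (simp_all add: z_def norm_mult norm_inverse norm_power norms power_mult_distrib
        divide_inverse power_inverse mult_ac)
  ultimately have n1: "(norm c / norm a) ^ m * norm (y $ 1) = (norm c / norm a) ^ n * norm (y $ 1)"
    and n2: "norm c ^ m * norm (y $ 2) = norm c ^ n * norm (y $ 2)"
    by metis+
  have "c \<noteq> 0" using Sp21_eigenvector_nonzero[OF L(1,4) v(1)] .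
  then have "norm c > 0" by simp
  then have "norm c / norm a > 0" "norm c / norm a < 1"
    using norms by (auto simp: divide_less_eq intro!: divide_pos_pos)
  then have "norm c ^ m \<noteq> norm c ^ n" "(norm c / norm a) ^ m \<noteq> (norm c / norm a) ^ n"
    using \<open>m \<noteq> n\<close> \<open>norm c > 0\<close> norms(1,3) by (subst power_inject_exp'; simp)+
  with n1 n2 have "y $ 1 = 0" "y $ 2 = 0" by auto
  then have "B *v v = v \<star> y $ 3" by (simp add: y cols_mult_vec)
  with B show False by blast
qed

end

lemma loxodromicI:
  assumes L: "L \<in> Sp21" "L *v p = p \<star> a" "norm a > 1" and p: "p \<noteq> 0" "hform p p = 0"
  obtains u v b c where "loxodromic L p u v a b c"
proof -
  have "a \<noteq> 0" using L by auto
  \<comment> \<open>The multiplier dual to \<open>a\<close>: under pairing with \<open>p\<close>,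
    the matrix \<open>L\<close> becomes left multiplication by \<open>c\<close>.\<close>
  define c where "c = inverse (qcnj a)"
  have nc: "norm c < 1"
    using L(3) by (simp add: c_def norm_inverse inverse_less_1_iff)
  have Lp: "hform (L *v w) p = c * hform w p" for w
    using Sp21_eigenvector_hform[OF L(1,2), of w] \<open>a \<noteq> 0\<close> by (simp add: c_def flip: mult.assoc)
  let ?f = "\<lambda>w. L *v w - w \<star> c"
  have "linear ?f"
    by (rule linearI) (simp_all add: matrix_vector_right_distrib rmult_add_left mult_scaleR_vector
        rmult_scaleR_left scaleR_diff_right)
  \<comment> \<open>Pairing \<open>?f x\<close> with \<open>p\<close> gives a commutator, of real
    part zero, so a vector whose pairing with \<open>p\<close> is one is not attained.\<close>
  moreover have "\<not> surj ?f"
  proof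
    obtain w where "hform w p \<noteq> 0"
      using hform_nondegenerate[of p] p(1) hform_eq_0_sym by blast
    assume "surj ?f"
    from surjD[OF this, of "w \<star> inverse (hform w p)"]
    obtain x where x: "w \<star> inverse (hform w p) = L *v x - x \<star> c" by blast
    then have "hform (w \<star> inverse (hform w p)) p = c * hform x p - hform x p * c"
      by (simp add: hform_diff_left Lp hform_rmult_left)
    with \<open>hform w p \<noteq> 0\<close> have "1 = c * hform x p - hform x p * c"
      by (simp add: hform_rmult_left)
    then have "QRe 1 = QRe (c * hform x p) - QRe (hform x p * c)"
      by (metis minus_quat.sel(1))
    then show False
      by (simp only: QRe_mult_commute[of c]) simp
  qed
  ultimately have "\<not> inj ?f"
    using linear_inj_imp_surj by blast
  with \<open>linear ?f\<close> obtain v where "v \<noteq> 0" "?f v = 0"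
    using linear_injective_0[of ?f] by blast
  then have v: "L *v v = v \<star> c" "v \<noteq> 0" by simp_all
  have "norm c \<noteq> 1" using nc by simp
  then have "QRe (hform v v) = 0"
    using Sp21_eigenvalue_norm[OF L(1) v(1)] by blast
  then have vv: "hform v v = 0"
    using hform_self[of v] by simp
  \<comment> \<open>Otherwise \<open>v = p \<star> t\<close> with \<open>a * t = t * c\<close>,
    against \<open>norm c < 1 < norm a\<close>.\<close>
  have vp: "hform v p \<noteq> 0"
  proof
    assume "hform v p = 0"
    then obtain t where t: "v = p \<star> t"
      using hform_nonpos_orthogonal[OF p(1), of v] p(2) vv by auto
    with v have "p \<star> (a * t) = p \<star> (t * c)"
      by (simp add: mult_rmult L rmult_assoc)
    then have "p \<star> (a * t - t * c) = 0" by (simp add: rmult_diff_right)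
    with p(1) have "a * t = t * c" by simp
    then have "norm a * norm t = norm t * norm c" by (metis norm_mult)
    moreover have "t \<noteq> 0" using t v by auto
    ultimately show False using L(3) nc by simp
  qed
  obtain u where u: "u \<noteq> 0" "hform u p = 0" "hform u v = 0"
    using nonzero_orthogonal_exists by blast
  have pv: "hform p v \<noteq> 0" using vp hform_eq_0_sym by blast
  have "\<exists>b. L *v u = u \<star> b"
  proof -
    have Lu: "hform (L *v u) p = 0" "hform (L *v u) v = 0"
      using Lp[of u] Sp21_eigenvector_hform[OF L(1) v(1), of u] u
        Sp21_eigenvector_nonzero[OF L(1) v] by auto
    have "y = 0" if "cols p u v *v y = 0" for y
    proof -
      have "hform v p * y $ 3 = 0" "hform p v * y $ 1 = 0"
        using arg_cong[OF that, of "\<lambda>x. hform x p"] arg_cong[OF that, of "\<lambda>x. hform x v"]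
        by (simp_all add: cols_mult_vec hform_add_left hform_rmult_left p u vv)
      with vp pv have y: "y $ 1 = 0" "y $ 3 = 0" by auto
      with that u(1) have "y $ 2 = 0" by (simp add: cols_mult_vec)
      with y show "y = 0" by (simp add: vec_eq_iff forall_3)
    qed
    then obtain y where y: "L *v u = cols p u v *v y" using cols_surj by metis
    have "hform v p * y $ 3 = 0" "hform p v * y $ 1 = 0"
      using arg_cong[OF y, of "\<lambda>x. hform x p"] arg_cong[OF y, of "\<lambda>x. hform x v"] Lu
      by (simp_all add: cols_mult_vec hform_add_left hform_rmult_left p u vv)
    with vp pv y have "L *v u = u \<star> y $ 2" by (simp add: cols_mult_vec)
    then show ?thesis by blast
  qed
  then obtain b where b: "L *v u = u \<star> b" by blast
  have "QRe (hform u u) \<noteq> 0"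
  proof
    assume "QRe (hform u u) = 0"
    then obtain t where "u = p \<star> t"
      using hform_nonpos_orthogonal[OF p(1), of u] p(2) u(2) by auto
    with u pv show False by (auto simp: hform_rmult_left)
  qed
  then have "norm b = 1" by (rule Sp21_eigenvalue_norm[OF L(1) b])
  show thesis
    by (rule that, unfold_locales) fact+
qed

section \<open>Groups fixing a line\<close>

lemma null_invariant_line_elementary:
  assumes G: "kleinian G"
    and p: "p \<noteq> 0" "hform p p = 0" and ev: "\<And>A. A \<in> G \<Longrightarrow> \<exists>a. A *v p = p \<star> a"
  shows "elementary G"
proof -
  have sub: "subgroup G Sp21_group" using G by (simp add: kleinian_def)
  note G' = subgroup_Sp21[OF sub]
  have nonpos: "QRe (hform p p) \<le> 0" using p by simp
  show ?thesis
  proof (cases "\<forall>A\<in>G. \<forall>a. A *v p = p \<star> a \<longrightarrow> norm a = 1")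
    case True
    have "norm (hform (A *v x) p) = norm (hform x p)" if "A \<in> G" for A x
    proof -
      obtain a where a: "A *v p = p \<star> a" using ev \<open>A \<in> G\<close> by blast
      then have "norm a = 1" using True that by blast
      moreover have "hform x p = qcnj a * hform (A *v x) p"
        using Sp21_eigenvector_hform[OF _ a] that G'(1) by blast
      ultimately show ?thesis by (simp add: norm_mult)
    qed
    \<comment> \<open>Using \<open>p\<close> for both vectors of \<open>elementaryI\<close> leaves
      at most one limit point.\<close>
    then show ?thesis
      by (intro elementaryI[OF G'(1) p(1) nonpos p(1) nonpos]) simp
  next
    case False
    then obtain A0 a0 where A0: "A0 \<in> G" "A0 *v p = p \<star> a0" "norm a0 \<noteq> 1" by blast
    then have Sp: "A0 \<in> Sp21" using G'(1) by blast
    \<comment> \<open>Passing to the inverse if necessary makes the modulus of the multiplier exceed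
      one.\<close>
    obtain L a where LG: "L \<in> G" "L *v p = p \<star> a" "norm a > 1"
    proof (cases "norm a0 > 1")
      case True
      with A0 that show thesis by blast
    next
      case False
      have "a0 \<noteq> 0" using Sp21_eigenvector_nonzero[OF Sp A0(2) p(1)] .
      with False A0(3) have "norm (inverse a0) > 1"
        by (simp add: norm_inverse one_less_inverse_iff)
      with that[OF G'(4)[OF A0(1)] adj_eigenvector[OF Sp A0(2) p(1)]] show thesis .
    qed
    have LSp: "L \<in> Sp21" using LG G'(1) by blast
    obtain u v b c where lox: "loxodromic L p u v a b c"
      using loxodromicI[OF LSp LG(2,3) p] by blast
    interpret loxodromic L p u v a b c by (rule lox)
    have fix_v: "\<exists>h. B *v v = v \<star> h" if B: "B \<in> G" for B
    proof (rule ccontr)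
      assume *: "\<not> ?thesis"
      obtain \<alpha> where \<alpha>: "B *v p = p \<star> \<alpha>" using ev B by blast
      have BSp: "B \<in> Sp21" using B G'(1) by blast
      have "range (\<lambda>n. adj (mpow L n) ** B ** mpow L n) \<subseteq> G"
        using G'(3,4) B mpow_in_subgroup[OF sub LG(1)] by blast
      moreover have "inj (\<lambda>n. adj (mpow L n) ** B ** mpow L n)"
        using inj_conjugates[OF BSp] * by blast
      ultimately show False
        using kleinian_bounded_not_inj[OF G _ bounded_conjugates[OF BSp \<alpha>]] by blast
    qed
    show ?thesis
    proof (rule elementaryI[OF G'(1) p(1) nonpos v(1)])
      show "QRe (hform v v) \<le> 0" using v by simp
      fix A x assume A: "A \<in> G"
      then have ASp: "A \<in> Sp21" using G'(1) by blast
      obtain \<alpha> \<beta> where ev: "A *v p = p \<star> \<alpha>" "A *v v = v \<star> \<beta>"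
        using ev[OF A] fix_v[OF A] by blast
      \<comment> \<open>Invariance of the nonzero pairing of \<open>v\<close> and \<open>p\<close>
        makes the moduli of the two multipliers reciprocal.\<close>
      have "hform v p = qcnj \<alpha> * hform v p * \<beta>"
        using Sp21_eigenvector_hform[OF ASp ev(1), of v] by (simp add: ev hform_rmult_left mult.assoc)
      then have "norm (hform v p) = norm \<alpha> * norm (hform v p) * norm \<beta>"
        by (metis norm_mult norm_qcnj)
      with orth(3) have one: "norm \<alpha> * norm \<beta> = 1" by simp
      have "norm (hform x p) * norm (hform x v)
          = (norm \<alpha> * norm \<beta>) * (norm (hform (A *v x) p) * norm (hform (A *v x) v))"
        using Sp21_eigenvector_hform[OF ASp ev(1), of x] Sp21_eigenvector_hform[OF ASp ev(2), of x]
        by (simp add: norm_mult)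
      then show "norm (hform (A *v x) p) * norm (hform (A *v x) v) = norm (hform x p) * norm (hform x v)"
        by (simp add: one)
    qed
  qed
qed

lemma negative_invariant_line_elementary:
  assumes G: "G \<subseteq> Sp21"
    and p: "QRe (hform p p) < 0" and ev: "\<And>A. A \<in> G \<Longrightarrow> \<exists>a. A *v p = p \<star> a"
  shows "elementary G"
proof (rule elementaryI[OF G])
  show "p \<noteq> 0" "p \<noteq> 0" "QRe (hform p p) \<le> 0" "QRe (hform p p) \<le> 0" using p by auto
  fix A x assume A: "A \<in> G"
  then obtain a where a: "A *v p = p \<star> a" using ev by blast
  have Sp: "A \<in> Sp21" using A G by blast
  have "norm a = 1" using Sp21_eigenvalue_norm[OF Sp a] p by simp
  then show "norm (hform (A *v x) p) * norm (hform (A *v x) p) = norm (hform x p) * norm (hform x p)"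
    using Sp21_eigenvector_hform[OF Sp a, of x] by (simp add: norm_mult)
qed

lemma invariant_line_fuchsian:
  assumes G: "kleinian G" "\<not> elementary G"
    and q: "q \<noteq> 0" "\<And>A. A \<in> G \<Longrightarrow> \<exists>a. A *v q = q \<star> a"
  shows "fuchsian G"
proof -
  have sub: "subgroup G Sp21_group" using G by (simp add: kleinian_def)
  consider "QRe (hform q q) < 0" | "QRe (hform q q) > 0" | "hform q q = 0"
    using hform_self[of q] by (cases "QRe (hform q q)" "0 :: real" rule: linorder_cases) auto
  then show ?thesis
    using negative_invariant_line_elementary[OF subgroup_Sp21(1)[OF sub] _ q(2)]
      positive_invariant_line_fuchsian[OF sub _ q(2)]
      null_invariant_line_elementary[OF G(1) q(1) _ q(2)] G(2) by cases auto
qed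

section \<open>The commutant of an irreducible group with real traces\<close>

text \<open>The hypotheses of Jacobson's density theorem, in the case where the commutant is the real field.\<close>

locale dense_algebra =
  fixes B :: "('v :: real_vector \<Rightarrow> 'v) set"
  assumes lin: "\<And>T. T \<in> B \<Longrightarrow> linear T"
    and add: "\<And>S T. S \<in> B \<Longrightarrow> T \<in> B \<Longrightarrow> (\<lambda>x. S x + T x) \<in> B"
    and scale: "\<And>r T. T \<in> B \<Longrightarrow> (\<lambda>x. r *\<^sub>R T x) \<in> B"
    and comp: "\<And>S T. S \<in> B \<Longrightarrow> T \<in> B \<Longrightarrow> (\<lambda>x. S (T x)) \<in> B"
    and trans: "\<And>x y. x \<noteq> 0 \<Longrightarrow> \<exists>T\<in>B. T x = y"
    and commutant: "\<And>S. linear S \<Longrightarrow> (\<And>T x. T \<in> B \<Longrightarrow> S (T x) = T (S x)) \<Longrightarrow> \<exists>r. \<forall>x. S x = r *\<^sub>R x"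
begin

text \<open>Let \<open>L\<close> be the annihilator of \<open>F\<close> in \<open>B\<close>. If
  every member of \<open>L\<close> killing \<open>w\<close> also killed \<open>v\<close>, then
  \<open>T w \<mapsto> T v\<close> would commute with \<open>B\<close>, hence be a scalar
  \<open>r\<close>; all of \<open>L\<close> would kill \<open>v - r *\<^sub>R w\<close>, which then
  lies in the span of \<open>F\<close> by induction.\<close>

lemma density:
  assumes "finite F" "v \<notin> span F"
  shows "\<exists>T\<in>B. T v \<noteq> 0 \<and> (\<forall>w\<in>F. T w = 0)"
  using \<open>finite F\<close> \<open>v \<notin> span F\<close>
proof (induction F arbitrary: v rule: finite_induct)
  case empty
  then have "v \<noteq> 0" by simp
  then obtain T where "T \<in> B" "T v = v" using trans by blast
  with \<open>v \<noteq> 0\<close> show ?case by (intro bexI[of _ T]) auto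
next
  case (insert w F)
  define L where "L = {T\<in>B. \<forall>f\<in>F. T f = 0}"
  have IH: "\<exists>T\<in>L. T x \<noteq> 0" if "x \<notin> span F" for x
    using insert.IH[OF that] by (auto simp: L_def)
  have L_add: "(\<lambda>x. S x + r *\<^sub>R T x) \<in> L" if "S \<in> L" "T \<in> L" for S T r
    using that add scale by (auto simp: L_def)
  have L_comp: "(\<lambda>x. S (T x)) \<in> L" if "S \<in> B" "T \<in> L" for S T
    using that comp lin[THEN linear_0] by (auto simp: L_def)
  have "v \<notin> span F" using insert.prems by (meson span_mono subset_insertI subsetD)
  show ?case
  proof (cases "w \<in> span F")
    case True
    obtain T where T: "T \<in> L" "T v \<noteq> 0" using IH[OF \<open>v \<notin> span F\<close>] by blast
    have "T x = 0" if "x \<in> span F" for x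
      using that by (rule linear_eq_0_on_span[OF lin, rotated -1]) (use T in \<open>auto simp: L_def\<close>)
    with T True show ?thesis by (auto simp: L_def)
  next
    case False
    show ?thesis
    proof (rule ccontr)
      assume "\<not> ?thesis"
      then have kill: "T v = 0" if "T \<in> L" "T w = 0" for T
        using that by (auto simp: L_def)
      obtain T0 where T0: "T0 \<in> L" "T0 w \<noteq> 0" using IH[OF False] by blast
      have surj: "\<exists>T. T \<in> L \<and> T w = y" for y
      proof -
        obtain R where "R \<in> B" "R (T0 w) = y" using trans[OF T0(2)] by blast
        with L_comp[OF _ T0(1)] show ?thesis by blast
      qed
      \<comment> \<open>\<open>g y\<close> picks a member of \<open>L\<close> sending
        \<open>w\<close> to \<open>y\<close>; by \<open>kill\<close> the value at \<open>v\<close>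
        does not depend on the choice.\<close>
      define g where "g y = (SOME T. T \<in> L \<and> T w = y)" for y
      have g: "g y \<in> L" "g y w = y" for y
        using someI_ex[OF surj[of y]] by (auto simp: g_def)
      define S where "S y = g y v" for y
      have S: "S (T w) = T v" if "T \<in> L" for T
        using kill[OF L_add[OF g(1) that, of "T w" "-1"]] by (simp add: g S_def)
      have "linear S"
      proof (rule linearI)
        show "S (x + y) = S x + S y" for x y
          using S[OF L_add[OF g(1) g(1), of x 1 y]] by (simp add: g S_def)
        show "S (r *\<^sub>R x) = r *\<^sub>R S x" for r x
          using S[OF L_add[OF g(1) g(1), of x "r - 1" x]]
          by (simp add: g S_def algebra_simps)
      qed
      moreover have "S (T x) = T (S x)" if "T \<in> B" for T x
        using S[OF L_comp[OF that g(1)], of x] by (simp add: g S_def)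
      ultimately obtain r where r: "\<And>x. S x = r *\<^sub>R x" using commutant by blast
      have "T (v - r *\<^sub>R w) = 0" if "T \<in> L" for T
      proof -
        have "linear T" using that lin by (auto simp: L_def)
        then show ?thesis
          using S[OF that] by (simp add: r linear_diff linear_scale)
      qed
      then have "v - r *\<^sub>R w \<in> span F" using IH by blast
      then have "v \<in> span (insert w F)"
        using span_breakdown_eq by blast
      with insert.prems show False by blast
    qed
  qed
qed

end

text \<open>Density and transitivity give, for each basis vector \<open>b\<close>, a member of
  \<open>B\<close> that agrees with \<open>f\<close> at \<open>b\<close> and kills the other basis
  vectors; these add up to \<open>f\<close>.\<close>

corollary density_linear:
  fixes B :: "('v :: euclidean_space \<Rightarrow> 'v) set"
  assumes "dense_algebra B" and f: "linear f"
  shows "f \<in> B"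
proof -
  interpret dense_algebra B by fact
  have "\<exists>T\<in>B. T b = f b \<and> (\<forall>b'\<in>Basis - {b}. T b' = 0)" if "b \<in> Basis" for b
  proof -
    have "b \<notin> span (Basis - {b})"
      using that independent_Basis dependent_def by blast
    then obtain T where T: "T \<in> B" "T b \<noteq> 0" "\<forall>b'\<in>Basis - {b}. T b' = 0"
      using density[of "Basis - {b}" b] by auto
    obtain R where R: "R \<in> B" "R (T b) = f b" using trans[OF T(2)] by blast
    have "(\<lambda>x. R (T x)) \<in> B" by (rule comp) fact+
    moreover have "R 0 = 0" using lin[OF R(1)] by (rule linear_0)
    ultimately show ?thesis using R T by (intro bexI[of _ "\<lambda>x. R (T x)"]) auto
  qed
  then obtain T where T: "\<And>b. b \<in> Basis \<Longrightarrow> T b \<in> B" "\<And>b. b \<in> Basis \<Longrightarrow> T b b = f b"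
    "\<And>b b'. b \<in> Basis \<Longrightarrow> b' \<in> Basis \<Longrightarrow> b' \<noteq> b \<Longrightarrow> T b b' = 0"
    by (metis Diff_iff singletonD)
  obtain b0 :: 'v where "b0 \<in> Basis" using nonempty_Basis by blast
  have zero: "(\<lambda>x. 0) \<in> B"
    using scale[OF T(1)[OF \<open>b0 \<in> Basis\<close>], of 0] by simp
  have sum: "(\<lambda>x. \<Sum>b\<in>A. T b x) \<in> B" if "finite A" "A \<subseteq> Basis" for A
    using that by (induction A rule: finite_induct) (auto simp: zero intro!: add T)
  have "f x = (\<Sum>b\<in>Basis. T b x)" for x
  proof (rule linear_eq_stdbasis[THEN fun_cong, OF f])
    show "linear (\<lambda>x. \<Sum>b\<in>Basis. T b x)" by (rule lin[OF sum]) auto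
    fix b :: 'v assume b: "b \<in> Basis"
    have "(\<Sum>b'\<in>Basis. T b' b) = (\<Sum>b'\<in>Basis. if b' = b then f b else 0)"
      using b T by (intro sum.cong) auto
    then show "f b = (\<Sum>b'\<in>Basis. T b' b)" using b by simp
  qed
  then have "f = (\<lambda>x. \<Sum>b\<in>Basis. T b x)" ..
  then show ?thesis using sum[of Basis] by simp
qed

section \<open>The algebra generated by a group and the right scalars\<close>

definition irreducible_group :: "(quat ^ 3 ^ 3) set \<Rightarrow> bool" where
  "irreducible_group G \<longleftrightarrow> (\<forall>W. (\<forall>w\<in>W. \<forall>w'\<in>W. w + w' \<in> W) \<longrightarrow> (\<forall>w\<in>W. \<forall>h. w \<star> h \<in> W) \<longrightarrow>
    (\<forall>A\<in>G. \<forall>w\<in>W. A *v w \<in> W) \<longrightarrow> (\<exists>w\<in>W. w \<noteq> 0) \<longrightarrow> W = UNIV)"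

lemma irreducible_groupD:
  assumes "irreducible_group G"
    and "\<And>w w'. w \<in> W \<Longrightarrow> w' \<in> W \<Longrightarrow> w + w' \<in> W" "\<And>w h. w \<in> W \<Longrightarrow> w \<star> h \<in> W"
    and "\<And>A w. A \<in> G \<Longrightarrow> w \<in> W \<Longrightarrow> A *v w \<in> W" "w \<in> W" "w \<noteq> 0"
  shows "W = UNIV"
  by (rule assms(1)[unfolded irreducible_group_def, rule_format]) (use assms(2-) in auto)

text \<open>Sums of generators suffice: left and right factors commute, so generators compose to
  generators when \<open>G\<close> is closed under products, and real factors are absorbed into
  \<open>h\<close>.\<close>

inductive_set bimodule_algebra :: "(quat ^ 3 ^ 3) set \<Rightarrow> (quat ^ 3 \<Rightarrow> quat ^ 3) set" for G where
  generator: "A \<in> G \<Longrightarrow> (\<lambda>v. A *v v \<star> h) \<in> bimodule_algebra G"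
| add: "S \<in> bimodule_algebra G \<Longrightarrow> T \<in> bimodule_algebra G \<Longrightarrow> (\<lambda>v. S v + T v) \<in> bimodule_algebra G"

lemma bimodule_algebra_linear: "T \<in> bimodule_algebra G \<Longrightarrow> linear T"
proof (induction rule: bimodule_algebra.induct)
  case (generator A h)
  show ?case
    by (rule linearI) (simp_all add: rmult_add_left rmult_scaleR_left matrix_vector_right_distrib mult_scaleR_vector)
qed (rule linear_compose_add)

lemma bimodule_algebra_scaleR: "T \<in> bimodule_algebra G \<Longrightarrow> (\<lambda>v. r *\<^sub>R T v) \<in> bimodule_algebra G"
proof (induction rule: bimodule_algebra.induct)
  case (generator A h)
  then show ?case
    using bimodule_algebra.generator[of A G "r *\<^sub>R h"]
    by (simp add: rmult_scaleR_right mult_scaleR_vector)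
qed (auto simp: scaleR_add_right intro: bimodule_algebra.add)

lemma bimodule_algebra_compose:
  assumes G: "\<And>A B. A \<in> G \<Longrightarrow> B \<in> G \<Longrightarrow> A ** B \<in> G"
    and "S \<in> bimodule_algebra G" "T \<in> bimodule_algebra G"
  shows "(\<lambda>v. S (T v)) \<in> bimodule_algebra G"
  using assms(2,3)
proof (induction arbitrary: T rule: bimodule_algebra.induct)
  case (generator A g)
  show ?case
    using generator.prems
  proof (induction rule: bimodule_algebra.induct)
    case (generator B h)
    then show ?case
      using bimodule_algebra.generator[OF G[OF \<open>A \<in> G\<close>], of B "h * g"]
      by (simp add: mult_rmult rmult_assoc matrix_vector_mul_assoc)
  next
    case (add S T)
    then show ?case
      using bimodule_algebra.add[OF add.IH] by (simp add: rmult_add_left matrix_vector_right_distrib)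
  qed
next
  case (add R S)
  show ?case
    by (rule bimodule_algebra.add[OF add.IH(1)[OF add.prems] add.IH(2)[OF add.prems]])
qed

abbreviation "qi \<equiv> Quat 0 1 0 0"
abbreviation "qj \<equiv> Quat 0 0 1 0"
abbreviation "qk \<equiv> Quat 0 0 0 1"

text \<open>Averaging over conjugation by the quaternion units leaves only the real part of the right
  factor, and so recovers a left multiplication from the algebra.\<close>

lemma bimodule_algebra_average:
  assumes "T \<in> bimodule_algebra G" "\<And>A. A \<in> G \<Longrightarrow> trace A \<in> \<real>"
  shows "\<exists>M. trace M \<in> \<real> \<and>
    (\<forall>v. T v - T (v \<star> qi) \<star> qi - T (v \<star> qj) \<star> qj - T (v \<star> qk) \<star> qk = M *v v)"
  using assms(1)
proof (induction rule: bimodule_algebra.induct)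
  case (generator A h)
  have avg: "h - qi * h * qi - qj * h * qj - qk * h * qk = of_real (4 * QRe h)"
    by (simp add: quat_eq_iff)
  have "A *v v \<star> h - (A *v (v \<star> qi \<star> h)) \<star> qi - (A *v (v \<star> qj \<star> h)) \<star> qj - (A *v (v \<star> qk \<star> h)) \<star> qk
      = ((4 * QRe h) *\<^sub>R A) *v v" for v
  proof -
    have "A *v v \<star> h - (A *v (v \<star> qi \<star> h)) \<star> qi - (A *v (v \<star> qj \<star> h)) \<star> qj - (A *v (v \<star> qk \<star> h)) \<star> qk
      = (A *v v) \<star> (h - qi * h * qi - qj * h * qj - qk * h * qk)"
      by (simp only: mult_rmult rmult_assoc rmult_diff_right)
    then show ?thesis
      unfolding avg by (simp only: rmult_of_real scaleR_mult_vector)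
  qed
  moreover have "trace (r *\<^sub>R A) = r *\<^sub>R trace A" for r
    by (simp add: trace_def sum_3 scaleR_add_right)
  then have "trace ((4 * QRe h) *\<^sub>R A) \<in> \<real>"
    using assms(2)[OF generator] by (simp only: scaleR_conv_of_real[where 'a = quat] Reals_mult Reals_of_real)
  ultimately show ?case by (intro exI conjI allI)
next
  case (add S T)
  then obtain M N where M: "trace M \<in> \<real>" "\<And>v. S v - S (v \<star> qi) \<star> qi - S (v \<star> qj) \<star> qj - S (v \<star> qk) \<star> qk = M *v v"
    and N: "trace N \<in> \<real>" "\<And>v. T v - T (v \<star> qi) \<star> qi - T (v \<star> qj) \<star> qj - T (v \<star> qk) \<star> qk = N *v v"
    by blast
  show ?case
  proof (intro exI conjI allI)
    have "trace (M + N) = trace M + trace N" by (simp add: trace_def sum.distrib)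
    then show "trace (M + N) \<in> \<real>" using M(1) N(1) by simp
    show "S v + T v - (S (v \<star> qi) + T (v \<star> qi)) \<star> qi - (S (v \<star> qj) + T (v \<star> qj)) \<star> qj
        - (S (v \<star> qk) + T (v \<star> qk)) \<star> qk = (M + N) *v v" for v
      unfolding matrix_vector_mult_add_rdistrib M(2)[symmetric] N(2)[symmetric]
      by (simp add: rmult_add_left)
  qed
qed

lemma real_trace_commutant:
  assumes G: "subgroup G Sp21_group" and irr: "irreducible_group G"
    and tr: "\<And>A. A \<in> G \<Longrightarrow> trace A \<in> \<real>"
  obtains X where "\<And>A. A \<in> G \<Longrightarrow> A ** X = X ** A" "\<And>r. X \<noteq> r *\<^sub>R mat 1"
proof (rule ccontr)
  assume "\<not> thesis"
  with that have scalar: "\<exists>r. X = r *\<^sub>R mat 1" if "\<And>A. A \<in> G \<Longrightarrow> A ** X = X ** A" for X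
    using that by blast
  note G' = subgroup_Sp21[OF G]
  let ?B = "bimodule_algebra G"
  \<comment> \<open>The diagonal matrix with entries i, 0, 0, whose trace is not real.\<close>
  define D where "D = cols (axis 1 1 \<star> qi) 0 0"
  have "dense_algebra ?B"
  proof (rule dense_algebra.intro)
    show "linear T" if "T \<in> ?B" for T by (rule bimodule_algebra_linear[OF that])
    show "(\<lambda>x. S x + T x) \<in> ?B" if "S \<in> ?B" "T \<in> ?B" for S T
      using that by (rule bimodule_algebra.add)
    show "(\<lambda>x. r *\<^sub>R T x) \<in> ?B" if "T \<in> ?B" for r T by (rule bimodule_algebra_scaleR[OF that])
    show "(\<lambda>x. S (T x)) \<in> ?B" if "S \<in> ?B" "T \<in> ?B" for S T
      using G'(3) that by (rule bimodule_algebra_compose)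
    show "\<exists>T\<in>?B. T x = y" if "x \<noteq> 0" for x y
    proof -
      \<comment> \<open>The image of \<open>x\<close> under the algebra is an invariant right
        subspace containing \<open>x\<close>, so irreducibility makes it everything.\<close>
      define W where "W = (\<lambda>T. T x) ` ?B"
      have id: "(\<lambda>v. mat 1 *v v \<star> h) \<in> ?B" for h
        using G'(2) by (rule bimodule_algebra.generator)
      have "W = UNIV"
      proof (rule irreducible_groupD[OF irr _ _ _ _ that])
        show "w + w' \<in> W" if "w \<in> W" "w' \<in> W" for w w'
        proof -
          obtain S T where ST: "S \<in> ?B" "T \<in> ?B" and w: "w = S x" "w' = T x" using \<open>w \<in> W\<close> \<open>w' \<in> W\<close> by (auto simp: W_def)
          show ?thesis unfolding W_def w by (rule image_eqI[OF _ bimodule_algebra.add[OF ST]]) simp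
        qed
        show "w \<star> h \<in> W" if "w \<in> W" for w h
        proof -
          obtain T where T: "T \<in> ?B" "w = T x" using \<open>w \<in> W\<close> by (auto simp: W_def)
          show ?thesis unfolding W_def T(2)
            by (rule image_eqI[OF _ bimodule_algebra_compose[OF G'(3) id T(1)]]) simp_all
        qed
        show "A *v w \<in> W" if "A \<in> G" "w \<in> W" for A w
        proof -
          obtain T where T: "T \<in> ?B" "w = T x" using \<open>w \<in> W\<close> by (auto simp: W_def)
          show ?thesis unfolding W_def T(2)
            by (rule image_eqI[OF _ bimodule_algebra_compose[OF G'(3) bimodule_algebra.generator[OF \<open>A \<in> G\<close>, of 1] T(1)]]) simp_all
        qed
        show "x \<in> W" unfolding W_def by (rule image_eqI[OF _ id[of 1]]) simp
      qed
      then have "y \<in> W" by simp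
      then show ?thesis by (auto simp: W_def)
    qed
    show "\<exists>r. \<forall>x. S x = r *\<^sub>R x" if S: "linear S" and comm: "\<And>T x. T \<in> ?B \<Longrightarrow> S (T x) = T (S x)" for S
    proof -
      \<comment> \<open>With the identity as left factor, commutation says that \<open>S\<close> is
        right quaternionic linear and hence given by a matrix.\<close>
      have S_rmult: "S (x \<star> h) = S x \<star> h" for x h
        using comm[OF bimodule_algebra.generator[OF G'(2), of h]] by simp
      define X where "X = cols (S (axis 1 1)) (S (axis 2 1)) (S (axis 3 1))"
      have X: "X *v x = S x" for x
      proof -
        have "S x = S (axis 1 1 \<star> x $ 1 + axis 2 1 \<star> x $ 2 + axis 3 1 \<star> x $ 3)"
          by (simp only: vec3_expand[symmetric])
        also have "\<dots> = X *v x"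
          by (simp add: X_def cols_mult_vec linear_add[OF S] S_rmult)
        finally show ?thesis ..
      qed
      have "A ** X = X ** A" if "A \<in> G" for A
        unfolding matrix_eq
        using comm[OF bimodule_algebra.generator[OF that, of 1]]
        by (simp add: X flip: matrix_vector_mul_assoc)
      then obtain r where "X = r *\<^sub>R mat 1" using scalar by blast
      then have "S x = r *\<^sub>R x" for x
        using X[of x] by (simp add: scaleR_mult_vector)
      then show ?thesis by blast
    qed
  qed
  then have "(*v) D \<in> ?B"
    by (rule density_linear) (rule matrix_vector_mul_linear)
  from bimodule_algebra_average[OF this tr] obtain M where M: "trace M \<in> \<real>"
    "\<And>v. D *v v - (D *v (v \<star> qi)) \<star> qi - (D *v (v \<star> qj)) \<star> qj - (D *v (v \<star> qk)) \<star> qk = M *v v"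
    by blast
  \<comment> \<open>\<open>D\<close> commutes with the right units, so averaging just multiplies it
    by four.\<close>
  have "M *v v = (4 *\<^sub>R D) *v v" for v
  proof -
    have "M *v v = (D *v v) \<star> (1 - qi * qi - qj * qj - qk * qk)"
      unfolding M(2)[symmetric] by (simp add: mult_rmult rmult_assoc rmult_diff_right)
    also have "1 - qi * qi - qj * qj - qk * qk = of_real 4"
      by (simp add: quat_eq_iff)
    finally show ?thesis by (simp only: rmult_of_real scaleR_mult_vector)
  qed
  then have "M = 4 *\<^sub>R D" by (simp add: matrix_eq)
  with M(1) show False
    by (simp add: trace_def sum_3 D_def cols_def axis_def quat_Reals_iff)
qed

lemma matrix_vector_mult_minus: "(- A) *v v = - (A *v v)" "A *v (- v) = - (A *v v)"
  for A :: "quat ^ 3 ^ 3"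
  by (simp_all add: vec_eq_iff matrix_vector_mult_def sum_negf)

section \<open>Eigenvectors\<close>

definition quat_of_complex :: "complex \<Rightarrow> quat" where
  "quat_of_complex z = Quat (Re z) (Im z) 0 0"

lemma quat_of_complex_simps [simp]:
  "quat_of_complex 0 = 0" "quat_of_complex 1 = 1" "quat_of_complex (- z) = - quat_of_complex z"
  "quat_of_complex (z + w) = quat_of_complex z + quat_of_complex w"
  "quat_of_complex (z * w) = quat_of_complex z * quat_of_complex w"
  "quat_of_complex (of_real r) = of_real r"
  by (simp_all add: quat_of_complex_def quat_eq_iff)

lemma quat_of_complex_commute:
  "quat_of_complex z * quat_of_complex w = quat_of_complex w * quat_of_complex z"
  by (metis mult.commute quat_of_complex_simps(5))

text \<open>The polynomial is evaluated at \<open>X\<close> in Horner form. Its coefficients are complex, rather than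
  quaternions, so that they commute with each other and linear factors can be split off.\<close>

definition poly_app :: "quat ^ 3 ^ 3 \<Rightarrow> complex poly \<Rightarrow> quat ^ 3 \<Rightarrow> quat ^ 3" where
  "poly_app X p v = fold_coeffs (\<lambda>c w. v \<star> quat_of_complex c + X *v w) p 0"

lemma poly_app_0 [simp]: "poly_app X 0 v = 0"
  by (simp add: poly_app_def)

lemma poly_app_pCons [simp]:
  "poly_app X (pCons c p) v = v \<star> quat_of_complex c + X *v poly_app X p v"
  by (cases "p = 0 \<and> c = 0") (auto simp: poly_app_def)

lemma poly_app_add: "poly_app X (p + q) v = poly_app X p v + poly_app X q v"
  by (induction p q rule: poly_induct2)
    (simp_all add: rmult_add_right matrix_vector_right_distrib)

lemma poly_app_smult: "poly_app X (smult c p) v = poly_app X p v \<star> quat_of_complex c"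
  by (induction p)
    (simp_all add: rmult_add_left rmult_assoc mult_rmult quat_of_complex_commute[of c])

lemma poly_app_sum: "poly_app X (sum p A) v = (\<Sum>k\<in>A. poly_app X (p k) v)"
  by (induction A rule: infinite_finite_induct) (auto simp: poly_app_add)

lemma poly_app_linear_factor:
  "poly_app X ([:- z, 1:] * q) v = X *v poly_app X q v - poly_app X q v \<star> quat_of_complex z"
proof -
  have "[:- z, 1:] * q = smult (- z) q + pCons 0 q" by simp
  then show ?thesis by (simp only: poly_app_add poly_app_smult) simp
qed

text \<open>Split off a linear factor: either the cofactor already kills \<open>v\<close> and has
  smaller degree, or its value at \<open>v\<close> is an eigenvector.\<close>

lemma eigenvector_of_poly:
  assumes "p \<noteq> 0" "poly_app X p v = 0" "v \<noteq> 0"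
  shows "\<exists>w z. w \<noteq> 0 \<and> X *v w = w \<star> quat_of_complex z"
  using assms(1,2)
proof (induction "degree p" arbitrary: p rule: less_induct)
  case less
  show ?case
  proof (cases "degree p = 0")
    case True
    then obtain c where c: "p = [:c:]" by (rule degree_eq_zeroE)
    with less.prems \<open>v \<noteq> 0\<close> show ?thesis
      by (auto simp: quat_of_complex_def quat_eq_iff complex_eq_iff)
  next
    case False
    then obtain z where "poly p z = 0"
      using fundamental_theorem_of_algebra[of p] constant_degree[of p] by auto
    then obtain q where q: "p = [:- z, 1:] * q"
      by (auto simp: poly_eq_0_iff_dvd elim: dvdE)
    with less.prems have "q \<noteq> 0" by auto
    show ?thesis
    proof (cases "poly_app X q v = 0")
      case True
      have "degree p = degree [:- z, 1:] + degree q"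
        unfolding q using \<open>q \<noteq> 0\<close> by (intro degree_mult_eq) auto
      then have "degree q < degree p" by simp
      with less.hyps \<open>q \<noteq> 0\<close> True show ?thesis by blast
    next
      case False
      have "X *v poly_app X q v = poly_app X q v \<star> quat_of_complex z"
        using less.prems(2) unfolding q poly_app_linear_factor by simp
      with False show ?thesis by blast
    qed
  qed
qed

text \<open>Linear dependence for a family rather than a set: a repeated value is treated
  separately, the relation then being the difference of the two terms.\<close>

lemma linear_relation_exists:
  fixes f :: "nat \<Rightarrow> 'a :: euclidean_space"
  obtains c where "\<exists>k\<le>DIM('a). c k \<noteq> 0" "(\<Sum>k\<le>DIM('a). c k *\<^sub>R f k) = 0"
proof (cases "inj_on f {..DIM('a)}")
  case True
  then have "card (f ` {..DIM('a)}) > DIM('a)" by (simp add: card_image)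
  then have "dependent (f ` {..DIM('a)})" by (rule dependent_biggerset)
  then obtain u where u: "\<exists>v\<in>f ` {..DIM('a)}. u v \<noteq> 0" "(\<Sum>v\<in>f ` {..DIM('a)}. u v *\<^sub>R v) = 0"
    by (subst (asm) dependent_finite) auto
  show thesis
    by (rule that[of "u \<circ> f"]) (use u True in \<open>auto simp: sum.reindex\<close>)
next
  case False
  then obtain i j where ij: "i \<le> DIM('a)" "j \<le> DIM('a)" "i \<noteq> j" "f i = f j"
    by (auto simp: inj_on_def)
  define c where "c k = (if k = i then 1 else 0) - (if k = j then 1 else 0 :: real)" for k
  have "(\<Sum>k\<le>DIM('a). c k *\<^sub>R f k) =
      (\<Sum>k\<le>DIM('a). if k = i then f k else 0) - (\<Sum>k\<le>DIM('a). if k = j then f k else 0)"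
    unfolding sum_subtractf[symmetric] by (rule sum.cong) (auto simp: c_def)
  then have "(\<Sum>k\<le>DIM('a). c k *\<^sub>R f k) = 0" using ij by simp
  moreover have "\<exists>k\<le>DIM('a). c k \<noteq> 0" using ij by (intro exI[of _ i]) (simp add: c_def)
  ultimately show thesis using that by blast
qed

text \<open>The powers of \<open>X\<close> up to the real dimension, applied to \<open>v\<close>,
  are linearly dependent over the reals, so a nonzero polynomial in \<open>X\<close> kills
  \<open>v\<close>.\<close>

lemma eigenvector_exists:
  obtains w z where "w \<noteq> 0" "X *v w = w \<star> quat_of_complex z"
proof -
  define v :: "quat ^ 3" where "v = axis 1 1"
  have v: "v \<noteq> 0" by (simp add: v_def axis_eq_0_iff)
  obtain c where c: "\<exists>k\<le>DIM(quat ^ 3). c k \<noteq> 0"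
    "(\<Sum>k\<le>DIM(quat ^ 3). c k *\<^sub>R poly_app X (monom 1 k) v) = 0"
    by (rule linear_relation_exists[of "\<lambda>k. poly_app X (monom 1 k) v"])
  define p :: "complex poly" where "p = (\<Sum>k\<le>DIM(quat ^ 3). smult (of_real (c k)) (monom 1 k))"
  have "poly_app X p v = 0"
    using c(2) by (simp only: p_def poly_app_sum poly_app_smult quat_of_complex_simps rmult_of_real)
  moreover have "coeff p k = of_real (c k)" if "k \<le> DIM(quat ^ 3)" for k
    using that by (simp add: p_def coeff_sum if_distrib cong: if_cong)
  then have "p \<noteq> 0" using c(1) by (metis coeff_0 of_real_eq_0_iff)
  ultimately show thesis using eigenvector_of_poly v that by blast
qed

section \<open>Invariant complex structures\<close>

text \<open>Schur's lemma: the kernel of \<open>Y\<close> is an invariant right subspace.\<close>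

lemma commutant_kernel:
  assumes irr: "irreducible_group G" and comm: "\<And>A. A \<in> G \<Longrightarrow> A ** Y = Y ** A"
    and w: "Y *v w = 0" "w \<noteq> 0"
  shows "Y = 0"
proof -
  have "{v. Y *v v = 0} = UNIV"
  proof (rule irreducible_groupD[OF irr])
    show "A *v v \<in> {v. Y *v v = 0}" if "A \<in> G" "v \<in> {v. Y *v v = 0}" for A v
      using that comm[OF that(1)] by (simp add: matrix_vector_mul_assoc flip: comm)
        (simp flip: matrix_vector_mul_assoc)
  qed (use w in \<open>auto simp: matrix_vector_right_distrib mult_rmult\<close>)
  then show ?thesis by (auto simp: matrix_eq)
qed

text \<open>The real quadratic polynomial with root \<open>z\<close>, evaluated at \<open>X\<close>,
  kills the eigenvector \<open>w\<close> and commutes with \<open>G\<close>, so it vanishes by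
  \<open>commutant_kernel\<close>. A real \<open>z\<close> would likewise make \<open>X\<close>
  scalar.\<close>

lemma commutant_quadratic:
  assumes irr: "irreducible_group G" and comm: "\<And>A. A \<in> G \<Longrightarrow> A ** X = X ** A"
    and nonscalar: "\<And>r. X \<noteq> r *\<^sub>R mat 1"
  shows "\<exists>a b. b \<noteq> 0 \<and> (\<forall>v. X *v (X *v v) = (2 * a) *\<^sub>R (X *v v) - (a\<^sup>2 + b\<^sup>2) *\<^sub>R v)"
proof -
  obtain w z where w: "w \<noteq> 0" "X *v w = w \<star> quat_of_complex z"
    using eigenvector_exists by blast
  have comm': "A ** (X - r *\<^sub>R mat 1) = (X - r *\<^sub>R mat 1) ** A" if "A \<in> G" for A r
    using comm[OF that]
    by (simp add: matrix_eq matrix_vector_mult_diff_rdistrib matrix_vector_mult_diff_distrib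
        scaleR_mult_vector mult_scaleR_vector flip: matrix_vector_mul_assoc)
  define Y where "Y = X - Re z *\<^sub>R mat 1"
  define Q where "Q = Y ** Y + (Im z)\<^sup>2 *\<^sub>R mat 1"
  have Yw: "Y *v w = w \<star> (Im z *\<^sub>R qi)"
  proof -
    have "Y *v w = w \<star> (quat_of_complex z - of_real (Re z))"
      by (simp add: Y_def matrix_vector_mult_diff_rdistrib scaleR_mult_vector w rmult_diff_right rmult_of_real)
    also have "quat_of_complex z - of_real (Re z) = Im z *\<^sub>R qi"
      by (simp add: quat_of_complex_def quat_eq_iff)
    finally show ?thesis .
  qed
  have "Im z \<noteq> 0"
  proof
    assume "Im z = 0"
    then have "Y *v w = 0" by (simp add: Yw)
    then have "Y = 0"
      using commutant_kernel[OF irr _ _ w(1), of Y] comm' by (simp add: Y_def)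
    with nonscalar show False by (simp add: Y_def)
  qed
  have "Q *v w = 0"
  proof -
    have "Y *v (Y *v w) = w \<star> ((Im z *\<^sub>R qi) * (Im z *\<^sub>R qi))"
      by (simp add: Yw mult_rmult rmult_assoc)
    also have "(Im z *\<^sub>R qi) * (Im z *\<^sub>R qi) = of_real (- (Im z)\<^sup>2)"
      by (simp add: quat_eq_iff power2_eq_square del: of_real_minus of_real_power)
    finally show ?thesis
      by (simp only: Q_def matrix_vector_mult_add_rdistrib scaleR_mult_vector rmult_of_real
          matrix_vector_mul_assoc[symmetric] matrix_vector_mul_lid) simp
  qed
  moreover have "A ** Q = Q ** A" if "A \<in> G" for A
  proof -
    have "A ** Y = Y ** A" using comm'[OF that] by (simp add: Y_def)
    then have "A *v (Y *v v) = Y *v (A *v v)" for v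
      by (simp add: matrix_vector_mul_assoc)
    then show ?thesis
      by (simp add: Q_def matrix_eq matrix_vector_mult_add_rdistrib matrix_vector_right_distrib
        scaleR_mult_vector mult_scaleR_vector flip: matrix_vector_mul_assoc)
  qed
  ultimately have "Q = 0" using commutant_kernel[OF irr _ _ w(1)] by blast
  then have Q: "Y *v (Y *v v) = - (Im z)\<^sup>2 *\<^sub>R v" for v
  proof -
    from \<open>Q = 0\<close> have "Q *v v = 0" by simp
    then show ?thesis
      unfolding Q_def by (simp add: matrix_vector_mult_add_rdistrib scaleR_mult_vector eq_neg_iff_add_eq_0
        flip: matrix_vector_mul_assoc)
  qed
  have X: "X *v v = Y *v v + Re z *\<^sub>R v" for v
    by (simp add: Y_def matrix_vector_mult_diff_rdistrib scaleR_mult_vector)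
  have "X *v (X *v v) = (2 * Re z) *\<^sub>R (X *v v) - ((Re z)\<^sup>2 + (Im z)\<^sup>2) *\<^sub>R v" for v
    unfolding X matrix_vector_right_distrib Q mult_scaleR_vector
    by (simp add: algebra_simps power2_eq_square flip: scaleR_2)
  with \<open>Im z \<noteq> 0\<close> show ?thesis by blast
qed

text \<open>A self-adjoint complex structure would exchange positive and negative vectors.\<close>

lemma no_self_adjoint_complex_structure:
  assumes "\<And>v. K *v (K *v v) = - v" "adj K = K"
  shows False
proof -
  \<comment> \<open>Positive and orthogonal to the positive vector \<open>axis 2 1\<close>;
    \<open>K\<close> would send the two to orthogonal negative vectors.\<close>
  let ?m = "axis 1 1 + axis 3 1 :: quat ^ 3"
  have K: "hform (K *v x) (K *v y) = - hform x y" for x y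
    by (simp add: hform_adj assms)
  have "hform (K *v axis 2 1) (K *v axis 2 1) = - 1"
    unfolding K by (simp add: hform_def axis_def)
  moreover have "hform (K *v ?m) (K *v axis 2 1) = 0" "QRe (hform (K *v ?m) (K *v ?m)) < 0"
    unfolding K by (simp_all add: hform_def axis_def)
  ultimately show False
    using hform_neg_orthogonal[of "K *v axis 2 1" "K *v ?m"] by force
qed

lemma commutant_complex_structure:
  assumes G: "subgroup G Sp21_group" and irr: "irreducible_group G"
    and X: "\<And>A. A \<in> G \<Longrightarrow> A ** X = X ** A" "\<And>r. X \<noteq> r *\<^sub>R mat 1"
  obtains K where "\<And>v. K *v (K *v v) = - v" "adj K = - K" "\<And>A. A \<in> G \<Longrightarrow> A ** K = K ** A"
proof -
  define Y where "Y = X - adj X"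
  have adjY: "adj Y = - Y" by (simp add: Y_def adj_diff)
  have "A ** adj X = adj X ** A" if "A \<in> G" for A
    using X(1)[OF subgroup_Sp21(4)[OF G that]] by (metis adj_adj adj_mult)
  then have Y_comm: "A ** Y = Y ** A" if "A \<in> G" for A
    using X(1) that
    by (simp add: Y_def matrix_eq matrix_vector_mult_diff_rdistrib matrix_vector_mult_diff_distrib
        flip: matrix_vector_mul_assoc)
  \<comment> \<open>Otherwise \<open>X\<close> is self-adjoint, and completing the square in its
    quadratic equation yields a self-adjoint complex structure.\<close>
  have "Y \<noteq> 0"
  proof
    assume "Y = 0"
    then have adjX: "adj X = X" by (simp add: Y_def)
    obtain a b where ab: "b \<noteq> 0" "\<And>v. X *v (X *v v) = (2 * a) *\<^sub>R (X *v v) - (a\<^sup>2 + b\<^sup>2) *\<^sub>R v"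
      using commutant_quadratic[OF irr X] by blast
    define K where "K = (1 / b) *\<^sub>R (X - a *\<^sub>R mat 1)"
    have "adj K = K" by (simp add: K_def adj_scaleR adj_diff adjX)
    moreover have "K *v (K *v v) = - v" for v
    proof -
      have "K *v (K *v v) = (1 / b\<^sup>2) *\<^sub>R (X *v (X *v v) - (2 * a) *\<^sub>R (X *v v) + a\<^sup>2 *\<^sub>R v)"
        by (simp add: K_def scaleR_mult_vector mult_scaleR_vector matrix_vector_mult_diff_rdistrib
            matrix_vector_mult_diff_distrib power2_eq_square algebra_simps flip: scaleR_2)
      also have "\<dots> = - v"
        using ab(1) by (simp add: ab(2) algebra_simps)
      finally show ?thesis .
    qed
    ultimately show False using no_self_adjoint_complex_structure by blast
  qed
  have Y_nonscalar: "Y \<noteq> r *\<^sub>R mat 1" for r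
  proof
    assume *: "Y = r *\<^sub>R mat 1"
    have "Y = - Y"
      unfolding adjY[symmetric] by (simp add: * adj_scaleR)
    with \<open>Y \<noteq> 0\<close> show False
      by (simp add: eq_neg_iff_add_eq_0 flip: scaleR_2)
  qed
  obtain a b where ab: "b \<noteq> 0" "\<And>v. Y *v (Y *v v) = (2 * a) *\<^sub>R (Y *v v) - (a\<^sup>2 + b\<^sup>2) *\<^sub>R v"
    using commutant_quadratic[OF irr Y_comm Y_nonscalar] by blast
  \<comment> \<open>Taking adjoints in the quadratic relation of the skew \<open>Y\<close> flips the
    sign of its linear term, which therefore vanishes.\<close>
  have "a = 0"
  proof (rule ccontr)
    assume "a \<noteq> 0"
    have "hform p (Y *v (Y *v q)) = hform p (- ((2 * a) *\<^sub>R (Y *v q)) - (a\<^sup>2 + b\<^sup>2) *\<^sub>R q)" for p q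
    proof -
      have "hform p (Y *v (Y *v q)) = hform (Y *v (Y *v p)) q"
        by (simp add: hform_adj adjY matrix_vector_mult_minus)
      also have "\<dots> = hform p (- ((2 * a) *\<^sub>R (Y *v q)) - (a\<^sup>2 + b\<^sup>2) *\<^sub>R q)"
        by (simp add: ab(2) hform_diff_left hform_diff_right hform_scaleR_left hform_scaleR_right
            hform_adj[of Y] adjY matrix_vector_mult_minus)
      finally show ?thesis .
    qed
    then have "Y *v (Y *v q) = - ((2 * a) *\<^sub>R (Y *v q)) - (a\<^sup>2 + b\<^sup>2) *\<^sub>R q" for q
      by (rule hform_nondegenerate_eq)
    then have "(2 * a) *\<^sub>R (Y *v q) = - ((2 * a) *\<^sub>R (Y *v q))" for q
      using ab(2)[of q] by simp
    then have "Y *v q = 0" for q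
      using \<open>a \<noteq> 0\<close> by (simp add: eq_neg_iff_add_eq_0 flip: scaleR_2)
    then have "Y = 0" by (simp add: matrix_eq)
    with \<open>Y \<noteq> 0\<close> show False ..
  qed
  show thesis
  proof (rule that[of "(1 / b) *\<^sub>R Y"])
    show "(1 / b) *\<^sub>R Y *v ((1 / b) *\<^sub>R Y *v v) = - v" for v
      using ab(1) by (simp add: scaleR_mult_vector mult_scaleR_vector ab(2) \<open>a = 0\<close> power2_eq_square)
    show "adj ((1 / b) *\<^sub>R Y) = - ((1 / b) *\<^sub>R Y)"
      by (simp add: adj_scaleR adjY)
    show "A ** (1 / b) *\<^sub>R Y = (1 / b) *\<^sub>R Y ** A" if "A \<in> G" for A
      using Y_comm[OF that] by (simp add: matrix_scalar_ac flip: scalar_matrix_assoc)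
  qed
qed

section \<open>The complex plane of a complex structure\<close>

lemma qi_commute_iff: "qi * h = h * qi \<longleftrightarrow> h \<in> quat_complex"
  by (auto simp: quat_eq_iff quat_complex_def)

locale complex_structure =
  fixes K :: "quat ^ 3 ^ 3"
  assumes K_K: "K *v (K *v v) = - v" and adj_K: "adj K = - K"
begin

text \<open>Only a complex subspace: on \<open>v \<star> qj\<close> with \<open>v\<close> in
  \<open>V\<close>, the matrix \<open>K\<close> acts as right multiplication by
  \<open>- qi\<close>.\<close>

definition V :: "(quat ^ 3) set" where
  "V = {v. K *v v = v \<star> qi}"

lemma V_scaleR: "v \<in> V \<Longrightarrow> r *\<^sub>R v \<in> V"
  by (simp add: V_def mult_scaleR_vector rmult_scaleR_left)

text \<open>The map sending \<open>x\<close> to \<open>(K *v x) \<star> qi\<close> is an involution,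
  with eigenspaces \<open>V\<close> for -1 and the right multiple of \<open>V\<close> by
  \<open>qj\<close> for +1. As \<open>K\<close> is skew, orthogonality to a vector of
  \<open>V\<close> passes to both components.\<close>

lemma V_decompose:
  obtains v w where "v \<in> V" "w \<in> V" "x = v + w \<star> qj"
    "\<And>a. a \<in> V \<Longrightarrow> hform x a = 0 \<Longrightarrow> hform v a = 0 \<and> hform w a = 0"
proof -
  define v where "v = (1 / 2) *\<^sub>R (x - (K *v x) \<star> qi)"
  define w where "w = - ((1 / 2) *\<^sub>R (x + (K *v x) \<star> qi)) \<star> qj"
  have qq: "qi * qi = - 1" "qj * qj = - 1" "qj * qi = - (qi * qj)"
    by (simp_all add: quat_eq_iff)
  have v: "v \<in> V"
    by (simp add: V_def v_def mult_scaleR_vector rmult_scaleR_left matrix_vector_mult_diff_distrib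
        mult_rmult K_K rmult_diff_left rmult_assoc qq)
  have w: "w \<in> V"
    by (simp add: V_def w_def mult_scaleR_vector rmult_scaleR_left matrix_vector_right_distrib
        matrix_vector_mult_minus mult_rmult K_K rmult_add_left rmult_assoc)
      (simp add: qq quat_eq_iff vec_eq_iff algebra_simps)
  have "w \<star> qj = (1 / 2) *\<^sub>R (x + (K *v x) \<star> qi)"
    by (simp add: w_def rmult_assoc qq del: rmult_simps(5))
  then have x: "x = v + w \<star> qj"
    by (simp add: v_def flip: scaleR_add_right scaleR_2)
  have "hform v a = 0 \<and> hform w a = 0" if "a \<in> V" "hform x a = 0" for a
  proof -
    have "hform (K *v x) a = - hform x (a \<star> qi)"
      using that(1) by (simp add: hform_adj adj_K matrix_vector_mult_minus V_def)
    also have "\<dots> = 0" by (simp add: hform_rmult_right that(2))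
    finally show ?thesis
      by (simp add: v_def w_def hform_scaleR_left hform_diff_left hform_add_left hform_rmult_left that(2))
  qed
  then show thesis using that v w x by blast
qed

text \<open>Skewness of \<open>K\<close> makes \<open>hform v w\<close> commute with
  \<open>qi\<close>.\<close>

lemma hform_V:
  assumes "v \<in> V" "w \<in> V"
  shows "hform v w \<in> quat_complex"
proof -
  have "hform (K *v v) w = - hform v (K *v w)"
    by (simp add: hform_adj adj_K matrix_vector_mult_minus)
  then have "hform v w * qi = qi * hform v w"
    using assms by (simp add: V_def hform_rmult_left hform_rmult_right) (simp add: quat_eq_iff)
  then show ?thesis by (metis qi_commute_iff)
qed

text \<open>The cross terms between \<open>V\<close> and its multiple by \<open>qj\<close> have real
  part zero, so one component of a negative vector is negative.\<close>

lemma V_negative: obtains v where "v \<in> V" "QRe (hform v v) < 0"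
proof -
  let ?x = "axis 1 1 - axis 3 1 :: quat ^ 3"
  obtain v w where vw: "v \<in> V" "w \<in> V" "?x = v + w \<star> qj" using V_decompose by blast
  have "hform ?x ?x = - 2" by (simp add: hform_def axis_def)
  then have "QRe (hform (v + w \<star> qj) (v + w \<star> qj)) < 0" by (simp flip: vw(3))
  moreover have "QRe (hform v (w \<star> qj)) = 0" "QRe (hform (w \<star> qj) v) = 0"
    using hform_V[OF vw(1,2)] hform_V[OF vw(2,1)]
    by (simp_all add: hform_rmult_left hform_rmult_right quat_complex_def)
  moreover have "QRe (hform (w \<star> qj) (w \<star> qj)) = QRe (hform w w)"
    by (simp add: hform_self_rmult norm_quat_def)
  ultimately have "QRe (hform v v) + QRe (hform w w) < 0"
    by (simp add: hform_add_left hform_add_right)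
  then have "QRe (hform v v) < 0 \<or> QRe (hform w w) < 0" by linarith
  then show thesis using that vw by blast
qed

text \<open>Both components of an orthogonal vector \<open>q\<close> are orthogonal to
  \<open>a\<close> and \<open>b\<close>, and one of them is nonzero.\<close>

lemma V_orthogonal:
  assumes "a \<in> V" "b \<in> V"
  obtains v where "v \<in> V" "v \<noteq> 0" "hform v a = 0" "hform v b = 0"
proof -
  obtain q where q: "q \<noteq> 0" "hform q a = 0" "hform q b = 0"
    using nonzero_orthogonal_exists by blast
  obtain v w where vw: "v \<in> V" "w \<in> V" "q = v + w \<star> qj"
    "\<And>a. a \<in> V \<Longrightarrow> hform q a = 0 \<Longrightarrow> hform v a = 0 \<and> hform w a = 0"
    using V_decompose by blast
  have "v \<noteq> 0 \<or> w \<noteq> 0" using q vw(3) by auto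
  then show thesis
    using that vw(1,2) vw(4)[OF assms(1) q(2)] vw(4)[OF assms(2) q(3)] by blast
qed

lemma V_frame:
  obtains a b c where "a \<in> V" "b \<in> V" "c \<in> V" "cols a b c \<in> Sp21"
proof -
  obtain n where n: "n \<in> V" "QRe (hform n n) < 0" using V_negative by blast
  obtain r where r: "hform (r *\<^sub>R n) (r *\<^sub>R n) = - 1"
    using normalize[of n] n(2) by auto
  obtain x where x: "x \<in> V" "x \<noteq> 0" "hform x n = 0"
    using V_orthogonal[OF n(1) n(1)] by blast
  obtain s where s: "hform (s *\<^sub>R x) (s *\<^sub>R x) = 1"
    using normalize[of x] hform_neg_orthogonal[OF n(2) x(3,2)] by auto
  obtain y where y: "y \<in> V" "y \<noteq> 0" "hform y n = 0" "hform y x = 0"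
    using V_orthogonal[OF n(1) x(1)] by blast
  obtain t where t: "hform (t *\<^sub>R y) (t *\<^sub>R y) = 1"
    using normalize[of y] hform_neg_orthogonal[OF n(2) y(3,2)] by auto
  have add: "v + w \<in> V" "v - w \<in> V" if "v \<in> V" "w \<in> V" for v w
    using that by (simp_all add: V_def matrix_vector_right_distrib matrix_vector_mult_diff_distrib
        rmult_add_left rmult_diff_left)
  show thesis
  proof
    show "cols ((1 / sqrt 2) *\<^sub>R (s *\<^sub>R x + r *\<^sub>R n)) (t *\<^sub>R y) ((1 / sqrt 2) *\<^sub>R (s *\<^sub>R x - r *\<^sub>R n)) \<in> Sp21"
      by (rule frame_Sp21[OF r s t])
        (simp_all add: hform_scaleR_left hform_scaleR_right x y)
  qed (use n x y in \<open>auto intro!: V_scaleR add\<close>)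
qed

lemma fuchsian_commutant:
  assumes G: "subgroup G Sp21_group" and comm: "\<And>A. A \<in> G \<Longrightarrow> A ** K = K ** A"
  shows "fuchsian G"
proof -
  obtain a b c where abc: "a \<in> V" "b \<in> V" "c \<in> V" and S: "cols a b c \<in> Sp21" (is "?S \<in> _")
    using V_frame by blast
  \<comment> \<open>In a frame taken from \<open>V\<close>, \<open>K\<close> is left multiplication
    of the coordinates by \<open>qi\<close>, so \<open>V\<close> consists of the vectors whose
    coordinates commute with \<open>qi\<close>.\<close>
  have KS: "K *v (?S *v p) = ?S *v (\<chi> i. qi * p $ i)" for p
    using abc by (simp add: cols_mult_vec matrix_vector_right_distrib mult_rmult V_def rmult_assoc)
  have S_V: "?S *v p \<in> V \<longleftrightarrow> (\<forall>i. p $ i \<in> quat_complex)" for p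
  proof -
    have "?S *v p \<in> V \<longleftrightarrow> ?S *v (\<chi> i. qi * p $ i) = ?S *v (p \<star> qi)"
      by (simp add: V_def KS mult_rmult)
    also have "\<dots> \<longleftrightarrow> (\<chi> i. qi * p $ i) = p \<star> qi"
      using S by (metis Sp21_adj_cancel(1))
    also have "\<dots> \<longleftrightarrow> (\<forall>i. p $ i \<in> quat_complex)"
      by (simp add: vec_eq_iff qi_commute_iff)
    finally show ?thesis .
  qed
  show ?thesis
  proof (rule fuchsianI[OF G S, of "\<lambda>p. \<forall>i. p $ i \<in> quat_complex"])
    fix A and p :: "quat ^ 3" assume A: "A \<in> G" and p: "\<forall>i. p $ i \<in> quat_complex"
    let ?p' = "adj ?S *v (A *v (?S *v p))"
    have eq: "A *v (?S *v p) = ?S *v ?p'" using S by simp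
    have "K *v (A *v v) = A *v (K *v v)" for v
      using comm[OF A] by (simp add: matrix_vector_mul_assoc)
    moreover have "?S *v p \<in> V" using p S_V by blast
    ultimately have "A *v (?S *v p) \<in> V"
      by (simp add: V_def mult_rmult)
    then have "?S *v ?p' \<in> V" using S by simp
    then show "\<exists>p'. (\<forall>i. p' $ i \<in> quat_complex) \<and> A *v (?S *v p) = ?S *v p'"
      using S_V by (intro exI[of _ ?p'] conjI eq) blast
  qed (simp add: std_complex_plane_def)
qed

end

theorem theorem1p3:
  fixes G :: "(quat ^ 3 ^ 3) set"
  assumes "kleinian G"
    and "\<not> elementary G"
    and "\<forall>A\<in>G. trace A \<in> \<real>"
  shows "fuchsian G"
proof -
  have G: "subgroup G Sp21_group" using assms(1) by (simp add: kleinian_def)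
  show ?thesis
  proof (cases "irreducible_group G")
    case True
    obtain X where X: "\<And>A. A \<in> G \<Longrightarrow> A ** X = X ** A" "\<And>r. X \<noteq> r *\<^sub>R mat 1"
      using real_trace_commutant[OF G True] assms(3) by blast
    obtain K where K: "\<And>v. K *v (K *v v) = - v" "adj K = - K" "\<And>A. A \<in> G \<Longrightarrow> A ** K = K ** A"
      using commutant_complex_structure[OF G True X] by blast
    interpret complex_structure K by unfold_locales (rule K)+
    show ?thesis by (rule fuchsian_commutant[OF G K(3)])
  next
    case False
    then obtain W where W: "\<forall>w\<in>W. \<forall>w'\<in>W. w + w' \<in> W" "\<forall>w\<in>W. \<forall>h. w \<star> h \<in> W"
      "\<forall>A\<in>G. \<forall>w\<in>W. A *v w \<in> W" "\<exists>w\<in>W. w \<noteq> 0" "W \<noteq> UNIV"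
      unfolding irreducible_group_def by blast
    then obtain w where w: "w \<in> W" "w \<noteq> 0" by blast
    obtain q where "q \<noteq> 0" "\<And>A. A \<in> G \<Longrightarrow> \<exists>a. A *v q = q \<star> a"
      using invariant_line_exists[OF G W(1,2,3)[rule_format] w W(5)] by blast
    then show ?thesis by (rule invariant_line_fuchsian[OF assms(1,2)])
  qed
qed

end
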